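(* Let $\mathbb{G}$ be a locally compact quantum group. There exists a conditional expectation $E:\mathcal{B}(L_2(\mathbb{G}))\rightarrow L_\infty(\hat{\mathbb{G}})$ satisfying $E(x\lhd\omega)=E(x)\lhd\omega$ for all $x\in\mathcal{B}(L_2(\mathbb{G}))$ and $\omega\in\mathcal{T}(L_2(\mathbb{G}))$ if and only if $L_\infty(\hat{\mathbb{G}})$ is injective (as a von Neumann algebra).
   Context: A locally compact quantum group (in the sense of Kustermans and Vaes) is $\mathbb{G}=(L_\infty(\mathbb{G}),\Gamma,\varphi,\psi)$, where $L_\infty(\mathbb{G})$ is a von Neumann algebra, $\Gamma:L_\infty(\mathbb{G})\to L_\infty(\mathbb{G})\bar\otimes L_\infty(\mathbb{G})$ is a co-associative co-multiplication (a unital injective normal $*$-homomorphism with $(\Gamma\otimes\mathrm{id})\Gamma=(\mathrm{id}\otimes\Gamma)\Gamma$), and $\varphi,\psi$ are fixed normal faithful semifinite left and right Haar weights. $L_1(\mathbb{G})$ is the predual of $L_\infty(\mathbb{G})$; $L_2(\mathbb{G})$ is the GNS space of $\varphi$ (identified in the standard way with that of $\psi$), on which $L_\infty(\mathbb{G})$ acts; $\mathcal{T}(L_2(\mathbb{G}))=\mathcal{B}(L_2(\mathbb{G}))_*$. The left fundamental unitary $W$ on $L_2(\mathbb{G})\otimes L_2(\mathbb{G})$ is given by $W^*(\Lambda_\varphi(x)\otimes\Lambda_\varphi(y))=(\Lambda_\varphi\otimes\Lambda_\varphi)(\Gamma(y)(x\otimes1))$ and satisfies $\Gamma(x)=W^*(1\otimes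 x)W$ for $x\in L_\infty(\mathbb{G})$. The von Neumann algebra of the dual quantum group is $L_\infty(\hat{\mathbb{G}})=\{(f\otimes\mathrm{id})(W):f\in L_1(\mathbb{G})\}''\subseteq\mathcal{B}(L_2(\mathbb{G}))$. For $x\in\mathcal{B}(L_2(\mathbb{G}))$, $\omega\in\mathcal{T}(L_2(\mathbb{G}))$ put $x\lhd\omega=(\omega\otimes\mathrm{id})(W^*(1\otimes x)W)\in\mathcal{B}(L_2(\mathbb{G}))$. A conditional expectation onto a von Neumann subalgebra is a (not necessarily normal) projection of norm one with that subalgebra as range. *)

theory Defs
  imports "HOL-Analysis.Analysis"
begin

section \<open>Complex Hilbert spaces and their bounded operators\<close>

text \<open>The inner product is conjugate-linear in the first argument. The real structure
  (norm, \<^const>\<open>inner\<close>, topology) is the one underlying the complex structure.\<close>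

class complex_hilbert = real_inner + complete_space +
  fixes scaleC :: "complex \<Rightarrow> 'a \<Rightarrow> 'a" (infixr "*\<^sub>C" 75)
    and cinner :: "'a \<Rightarrow> 'a \<Rightarrow> complex"
  assumes scaleC_add_right: "c *\<^sub>C (x + y) = c *\<^sub>C x + c *\<^sub>C y"
    and scaleC_add_left: "(c + d) *\<^sub>C x = c *\<^sub>C x + d *\<^sub>C x"
    and scaleC_scaleC: "c *\<^sub>C d *\<^sub>C x = (c * d) *\<^sub>C x"
    and scaleC_of_real: "complex_of_real r *\<^sub>C x = r *\<^sub>R x"
    and cinner_commute: "cinner x y = cnj (cinner y x)"
    and cinner_add_right: "cinner x (y + z) = cinner x y + cinner x z"
    and cinner_scaleC_right: "cinner x (c *\<^sub>C y) = c * cinner x y"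
    and Re_cinner: "Re (cinner x y) = inner x y"

text \<open>The type of bounded operators of the library only records real linearity;
  \<open>BH\<close> is the set of complex-linear ones, so \<open>BH :: ('h \<Rightarrow>\<^sub>L 'h) set\<close> is \<open>\<B>(H)\<close>.\<close>

definition BH :: "('a::complex_hilbert \<Rightarrow>\<^sub>L 'b::complex_hilbert) set" where
  "BH = {T. \<forall>c x. blinfun_apply T (c *\<^sub>C x) = c *\<^sub>C blinfun_apply T x}"

definition scale_op ::
    "complex \<Rightarrow> ('a::complex_hilbert \<Rightarrow>\<^sub>L 'b::complex_hilbert) \<Rightarrow> 'a \<Rightarrow>\<^sub>L 'b" where
  "scale_op c T = Blinfun (\<lambda>x. c *\<^sub>C blinfun_apply T x)"

definition adj :: "('a::complex_hilbert \<Rightarrow>\<^sub>L 'b::complex_hilbert) \<Rightarrow> 'b \<Rightarrow>\<^sub>L 'a" where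
  "adj T = (THE S. S \<in> BH \<and> (\<forall>x y. cinner (blinfun_apply T x) y = cinner x (blinfun_apply S y)))"

definition unitary_op :: "('a::complex_hilbert \<Rightarrow>\<^sub>L 'a) \<Rightarrow> bool" where
  "unitary_op U \<longleftrightarrow> U \<in> BH \<and> adj U o\<^sub>L U = id_blinfun \<and> U o\<^sub>L adj U = id_blinfun"

definition positive_op :: "('a::complex_hilbert \<Rightarrow>\<^sub>L 'a) \<Rightarrow> bool" where
  "positive_op T \<longleftrightarrow> T \<in> BH \<and>
     (\<forall>x. Im (cinner x (blinfun_apply T x)) = 0 \<and> 0 \<le> Re (cinner x (blinfun_apply T x)))"

definition op_le :: "('a::complex_hilbert \<Rightarrow>\<^sub>L 'a) \<Rightarrow> ('a \<Rightarrow>\<^sub>L 'a) \<Rightarrow> bool" where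
  "op_le S T \<longleftrightarrow> positive_op (T - S)"

section \<open>Von Neumann algebras, preduals and normal maps\<close>

definition commutant :: "('h::complex_hilbert \<Rightarrow>\<^sub>L 'h) set \<Rightarrow> ('h \<Rightarrow>\<^sub>L 'h) set" where
  "commutant A = {T \<in> BH. \<forall>a\<in>A. T o\<^sub>L a = a o\<^sub>L T}"

definition von_neumann_algebra :: "('h::complex_hilbert \<Rightarrow>\<^sub>L 'h) set \<Rightarrow> bool" where
  "von_neumann_algebra M \<longleftrightarrow> M \<subseteq> BH \<and> adj ` M \<subseteq> M \<and> commutant (commutant M) = M"

definition positive_part :: "('h::complex_hilbert \<Rightarrow>\<^sub>L 'h) set \<Rightarrow> ('h \<Rightarrow>\<^sub>L 'h) set" where
  "positive_part M = {x \<in> M. positive_op x}"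

text \<open>\<open>\<T>(H) = \<B>(H)\<^sub>*\<close>, as functionals on \<open>\<B>(H)\<close>: every trace class operator is a sum
  \<open>\<Sum>n. |\<xi>\<^sub>n\<rangle>\<langle>\<eta>\<^sub>n|\<close> with square-summable \<open>\<xi>\<close>, \<open>\<eta>\<close>, and acts by the trace pairing. Only the
  values on \<^const>\<open>BH\<close> are meaningful.\<close>

definition trace_class_functionals :: "(('h::complex_hilbert \<Rightarrow>\<^sub>L 'h) \<Rightarrow> complex) set" where
  "trace_class_functionals = {\<omega>. \<exists>\<xi> \<eta>. summable (\<lambda>n. (norm (\<xi> n))\<^sup>2) \<and> summable (\<lambda>n. (norm (\<eta> n))\<^sup>2) \<and>
     (\<forall>x\<in>BH. \<omega> x = (\<Sum>n. cinner (\<eta> n) (blinfun_apply x (\<xi> n))))}"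

text \<open>The normal (i.e. \<open>\<sigma>\<close>-weakly continuous) functionals on \<open>M\<close>; these are the restrictions of
  the normal functionals on \<open>\<B>(H)\<close>.\<close>

definition predual ::
    "('h::complex_hilbert \<Rightarrow>\<^sub>L 'h) set \<Rightarrow> (('h \<Rightarrow>\<^sub>L 'h) \<Rightarrow> complex) set" where
  "predual M = {restrict \<omega> M | \<omega>. \<omega> \<in> trace_class_functionals}"

text \<open>Unital \<open>\<sigma>\<close>-weakly continuous \<open>*\<close>-homomorphism from \<open>M\<close> into \<open>N\<close>; the last clause is
  \<open>\<sigma>\<close>-weak continuity.\<close>

definition normal_unital_star_hom ::
    "('h::complex_hilbert \<Rightarrow>\<^sub>L 'h) set \<Rightarrow> ('k::complex_hilbert \<Rightarrow>\<^sub>L 'k) set \<Rightarrow>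
     (('h \<Rightarrow>\<^sub>L 'h) \<Rightarrow> ('k \<Rightarrow>\<^sub>L 'k)) \<Rightarrow> bool" where
  "normal_unital_star_hom M N \<Phi> \<longleftrightarrow>
     \<Phi> ` M \<subseteq> N \<and> \<Phi> id_blinfun = id_blinfun \<and>
     (\<forall>x\<in>M. \<forall>y\<in>M. \<Phi> (x + y) = \<Phi> x + \<Phi> y \<and> \<Phi> (x o\<^sub>L y) = \<Phi> x o\<^sub>L \<Phi> y) \<and>
     (\<forall>c. \<forall>x\<in>M. \<Phi> (scale_op c x) = scale_op c (\<Phi> x)) \<and>
     (\<forall>x\<in>M. \<Phi> (adj x) = adj (\<Phi> x)) \<and>
     (\<forall>f\<in>predual N. \<exists>g\<in>predual M. \<forall>x\<in>M. f (\<Phi> x) = g x)"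

text \<open>A not necessarily normal projection of norm one from \<open>\<B>(H)\<close> onto \<open>N\<close>. As \<open>E\<close> fixes
  \<open>1 \<in> N\<close>, contractivity means that the norm is exactly one (unless \<open>H = 0\<close>).\<close>

definition conditional_expectation ::
    "('h::complex_hilbert \<Rightarrow>\<^sub>L 'h) set \<Rightarrow> (('h \<Rightarrow>\<^sub>L 'h) \<Rightarrow> ('h \<Rightarrow>\<^sub>L 'h)) \<Rightarrow> bool" where
  "conditional_expectation N E \<longleftrightarrow>
     (\<forall>x\<in>BH. \<forall>y\<in>BH. E (x + y) = E x + E y) \<and>
     (\<forall>c. \<forall>x\<in>BH. E (scale_op c x) = scale_op c (E x)) \<and>
     E ` BH \<subseteq> N \<and> (\<forall>x\<in>N. E x = x) \<and>
     (\<forall>x\<in>BH. norm (E x) \<le> norm x)"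

text \<open>Injectivity of a von Neumann algebra \<open>N \<subseteq> \<B>(H)\<close> in the sense of Connes, which does not
  depend on the faithful normal representation of \<open>N\<close>.\<close>

definition injective_vN :: "('h::complex_hilbert \<Rightarrow>\<^sub>L 'h) set \<Rightarrow> bool" where
  "injective_vN N \<longleftrightarrow> (\<exists>E. conditional_expectation N E)"

section \<open>Tensor products\<close>

text \<open>\<open>t\<close> exhibits the type \<open>'c\<close> as the Hilbert space tensor product of \<open>'a\<close> and \<open>'b\<close>, which is
  unique up to unitary equivalence. The real span of the elementary tensors is their complex span,
  since \<open>c (a \<otimes> b) = (c a) \<otimes> b\<close>.\<close>

definition hilbert_tensor ::
    "('a::complex_hilbert \<Rightarrow> 'b::complex_hilbert \<Rightarrow> 'c::complex_hilbert) \<Rightarrow> bool" where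
  "hilbert_tensor t \<longleftrightarrow>
     (\<forall>a a' b. t (a + a') b = t a b + t a' b) \<and>
     (\<forall>a b b'. t a (b + b') = t a b + t a b') \<and>
     (\<forall>c a b. t (c *\<^sub>C a) b = c *\<^sub>C t a b \<and> t a (c *\<^sub>C b) = c *\<^sub>C t a b) \<and>
     (\<forall>a b a' b'. cinner (t a b) (t a' b') = cinner a a' * cinner b b') \<and>
     closure (span {t a b | a b. True}) = UNIV"

definition op_tensor ::
    "('a::complex_hilbert \<Rightarrow> 'b::complex_hilbert \<Rightarrow> 'c::complex_hilbert) \<Rightarrow>
     ('a \<Rightarrow>\<^sub>L 'a) \<Rightarrow> ('b \<Rightarrow>\<^sub>L 'b) \<Rightarrow> 'c \<Rightarrow>\<^sub>L 'c" where
  "op_tensor t x y = (THE T. T \<in> BH \<and>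
     (\<forall>a b. blinfun_apply T (t a b) = t (blinfun_apply x a) (blinfun_apply y b)))"

definition vN_tensor ::
    "('a::complex_hilbert \<Rightarrow> 'b::complex_hilbert \<Rightarrow> 'c::complex_hilbert) \<Rightarrow>
     ('a \<Rightarrow>\<^sub>L 'a) set \<Rightarrow> ('b \<Rightarrow>\<^sub>L 'b) set \<Rightarrow> ('c \<Rightarrow>\<^sub>L 'c) set" where
  "vN_tensor t M N = commutant (commutant {op_tensor t x y | x y. x \<in> M \<and> y \<in> N})"

text \<open>\<open>vector_slice t \<xi> \<eta> X = (id \<otimes> \<omega>\<^bsub>\<xi>,\<eta>\<^esub>)(X)\<close>, where \<open>\<omega>\<^bsub>\<xi>,\<eta>\<^esub>(y) = \<langle>\<eta>, y \<xi>\<rangle>\<close>.\<close>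

definition vector_slice ::
    "('a::complex_hilbert \<Rightarrow> 'b::complex_hilbert \<Rightarrow> 'c::complex_hilbert) \<Rightarrow>
     'b \<Rightarrow> 'b \<Rightarrow> ('c \<Rightarrow>\<^sub>L 'c) \<Rightarrow> 'a \<Rightarrow>\<^sub>L 'a" where
  "vector_slice t \<xi> \<eta> X = (THE R. R \<in> BH \<and>
     (\<forall>a b. cinner b (blinfun_apply R a) = cinner (t b \<eta>) (blinfun_apply X (t a \<xi>))))"

text \<open>\<open>slice_left t \<omega> X = (\<omega> \<otimes> id)(X)\<close> and \<open>slice_right t \<omega> X = (id \<otimes> \<omega>)(X)\<close>.\<close>

definition slice_left ::
    "('a::complex_hilbert \<Rightarrow> 'b::complex_hilbert \<Rightarrow> 'c::complex_hilbert) \<Rightarrow>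
     (('a \<Rightarrow>\<^sub>L 'a) \<Rightarrow> complex) \<Rightarrow> ('c \<Rightarrow>\<^sub>L 'c) \<Rightarrow> 'b \<Rightarrow>\<^sub>L 'b" where
  "slice_left t \<omega> X = (THE S. S \<in> BH \<and>
     (\<forall>\<xi> \<eta>. cinner \<eta> (blinfun_apply S \<xi>) = \<omega> (vector_slice t \<xi> \<eta> X)))"

definition slice_right ::
    "('a::complex_hilbert \<Rightarrow> 'b::complex_hilbert \<Rightarrow> 'c::complex_hilbert) \<Rightarrow>
     (('b \<Rightarrow>\<^sub>L 'b) \<Rightarrow> complex) \<Rightarrow> ('c \<Rightarrow>\<^sub>L 'c) \<Rightarrow> 'a \<Rightarrow>\<^sub>L 'a" where
  "slice_right t \<omega> X = slice_left (\<lambda>b a. t a b) \<omega> X"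

section \<open>Weights\<close>

text \<open>A weight is only meaningful on the positive part of \<open>M\<close>. In \<^typ>\<open>ennreal\<close> one has
  \<open>0 * \<infinity> = 0\<close>, as required.\<close>

definition weight :: "('h::complex_hilbert \<Rightarrow>\<^sub>L 'h) set \<Rightarrow> (('h \<Rightarrow>\<^sub>L 'h) \<Rightarrow> ennreal) \<Rightarrow> bool" where
  "weight M \<phi> \<longleftrightarrow>
     (\<forall>x\<in>positive_part M. \<forall>y\<in>positive_part M. \<phi> (x + y) = \<phi> x + \<phi> y) \<and>
     (\<forall>r\<ge>0. \<forall>x\<in>positive_part M. \<phi> (r *\<^sub>R x) = ennreal r * \<phi> x)"

definition is_lub_in :: "('h::complex_hilbert \<Rightarrow>\<^sub>L 'h) set \<Rightarrow> ('h \<Rightarrow>\<^sub>L 'h) set \<Rightarrow> ('h \<Rightarrow>\<^sub>L 'h) \<Rightarrow> bool" where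
  "is_lub_in P D s \<longleftrightarrow> s \<in> P \<and> (\<forall>d\<in>D. op_le d s) \<and> (\<forall>u\<in>P. (\<forall>d\<in>D. op_le d u) \<longrightarrow> op_le s u)"

definition normal_weight ::
    "('h::complex_hilbert \<Rightarrow>\<^sub>L 'h) set \<Rightarrow> (('h \<Rightarrow>\<^sub>L 'h) \<Rightarrow> ennreal) \<Rightarrow> bool" where
  "normal_weight M \<phi> \<longleftrightarrow>
     (\<forall>D s. D \<noteq> {} \<and> D \<subseteq> positive_part M \<and>
        (\<forall>a\<in>D. \<forall>b\<in>D. \<exists>c\<in>D. op_le a c \<and> op_le b c) \<and> is_lub_in (positive_part M) D s
        \<longrightarrow> \<phi> s = (SUP d\<in>D. \<phi> d))"

definition faithful_weight ::
    "('h::complex_hilbert \<Rightarrow>\<^sub>L 'h) set \<Rightarrow> (('h \<Rightarrow>\<^sub>L 'h) \<Rightarrow> ennreal) \<Rightarrow> bool" where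
  "faithful_weight M \<phi> \<longleftrightarrow> (\<forall>x\<in>positive_part M. \<phi> x = 0 \<longrightarrow> x = 0)"

text \<open>Semifinite: the positive elements of finite weight generate \<open>M\<close> as a von Neumann algebra.\<close>

definition semifinite_weight ::
    "('h::complex_hilbert \<Rightarrow>\<^sub>L 'h) set \<Rightarrow> (('h \<Rightarrow>\<^sub>L 'h) \<Rightarrow> ennreal) \<Rightarrow> bool" where
  "semifinite_weight M \<phi> \<longleftrightarrow>
     commutant (commutant {x \<in> positive_part M. \<phi> x < \<infinity>}) = M"

definition nsf_weight ::
    "('h::complex_hilbert \<Rightarrow>\<^sub>L 'h) set \<Rightarrow> (('h \<Rightarrow>\<^sub>L 'h) \<Rightarrow> ennreal) \<Rightarrow> bool" where
  "nsf_weight M \<phi> \<longleftrightarrow>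
     weight M \<phi> \<and> normal_weight M \<phi> \<and> semifinite_weight M \<phi> \<and> faithful_weight M \<phi>"

text \<open>The left ideal \<open>\<n>\<^sub>\<phi>\<close>.\<close>

definition n_ideal ::
    "('h::complex_hilbert \<Rightarrow>\<^sub>L 'h) set \<Rightarrow> (('h \<Rightarrow>\<^sub>L 'h) \<Rightarrow> ennreal) \<Rightarrow> ('h \<Rightarrow>\<^sub>L 'h) set" where
  "n_ideal M \<phi> = {x \<in> M. \<phi> (adj x o\<^sub>L x) < \<infinity>}"

text \<open>\<open>H\<close> is the GNS space of \<open>\<phi>\<close> with GNS map \<open>\<Lambda>\<close> and \<open>M \<subseteq> \<B>(H)\<close> acts by the GNS
  representation. By polarization, \<open>\<parallel>\<Lambda> x\<parallel>\<^sup>2 = \<phi>(x\<^sup>* x)\<close> is \<open>\<langle>\<Lambda> y, \<Lambda> x\<rangle> = \<phi>(y\<^sup>* x)\<close>.\<close>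

definition GNS_map ::
    "('h::complex_hilbert \<Rightarrow>\<^sub>L 'h) set \<Rightarrow> (('h \<Rightarrow>\<^sub>L 'h) \<Rightarrow> ennreal) \<Rightarrow> (('h \<Rightarrow>\<^sub>L 'h) \<Rightarrow> 'h) \<Rightarrow> bool" where
  "GNS_map M \<phi> \<Lambda> \<longleftrightarrow>
     (\<forall>x\<in>n_ideal M \<phi>. \<forall>y\<in>n_ideal M \<phi>. \<Lambda> (x + y) = \<Lambda> x + \<Lambda> y) \<and>
     (\<forall>c. \<forall>x\<in>n_ideal M \<phi>. \<Lambda> (scale_op c x) = c *\<^sub>C \<Lambda> x) \<and>
     (\<forall>x\<in>n_ideal M \<phi>. ennreal ((norm (\<Lambda> x))\<^sup>2) = \<phi> (adj x o\<^sub>L x)) \<and>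
     closure (\<Lambda> ` n_ideal M \<phi>) = UNIV \<and>
     (\<forall>x\<in>M. \<forall>y\<in>n_ideal M \<phi>. \<Lambda> (x o\<^sub>L y) = blinfun_apply x (\<Lambda> y))"

section \<open>Locally compact quantum groups\<close>

text \<open>Left and right invariance. A positive \<open>f \<in> L\<^sub>1(\<GG>)\<close> is represented by any \<open>\<omega> \<in> \<T>(H)\<close> with
  \<open>\<omega> = f\<close> on \<open>M\<close>; the slices of \<open>\<Gamma> x\<close> depend on \<open>f\<close> only.\<close>

definition left_invariant_weight ::
    "('h::complex_hilbert \<Rightarrow> 'h \<Rightarrow> 'h2::complex_hilbert) \<Rightarrow> ('h \<Rightarrow>\<^sub>L 'h) set \<Rightarrow>
     (('h \<Rightarrow>\<^sub>L 'h) \<Rightarrow> ('h2 \<Rightarrow>\<^sub>L 'h2)) \<Rightarrow> (('h \<Rightarrow>\<^sub>L 'h) \<Rightarrow> ennreal) \<Rightarrow> bool" where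
  "left_invariant_weight t M \<Gamma> \<phi> \<longleftrightarrow>
     (\<forall>\<omega>\<in>trace_class_functionals. (\<forall>y\<in>positive_part M. Im (\<omega> y) = 0 \<and> 0 \<le> Re (\<omega> y)) \<longrightarrow>
        (\<forall>x\<in>positive_part M. \<phi> x < \<infinity> \<longrightarrow>
           \<phi> (slice_left t \<omega> (\<Gamma> x)) = ennreal (Re (\<omega> id_blinfun)) * \<phi> x))"

definition right_invariant_weight ::
    "('h::complex_hilbert \<Rightarrow> 'h \<Rightarrow> 'h2::complex_hilbert) \<Rightarrow> ('h \<Rightarrow>\<^sub>L 'h) set \<Rightarrow>
     (('h \<Rightarrow>\<^sub>L 'h) \<Rightarrow> ('h2 \<Rightarrow>\<^sub>L 'h2)) \<Rightarrow> (('h \<Rightarrow>\<^sub>L 'h) \<Rightarrow> ennreal) \<Rightarrow> bool" where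
  "right_invariant_weight t M \<Gamma> \<psi> \<longleftrightarrow>
     (\<forall>\<omega>\<in>trace_class_functionals. (\<forall>y\<in>positive_part M. Im (\<omega> y) = 0 \<and> 0 \<le> Re (\<omega> y)) \<longrightarrow>
        (\<forall>x\<in>positive_part M. \<psi> x < \<infinity> \<longrightarrow>
           \<psi> (slice_right t \<omega> (\<Gamma> x)) = ennreal (Re (\<omega> id_blinfun)) * \<psi> x))"

text \<open>\<open>(\<Gamma> \<otimes> id)\<Gamma> = (id \<otimes> \<Gamma>)\<Gamma>\<close>. Here \<open>\<Phi> = \<Gamma> \<otimes> id\<close> and \<open>\<Psi> = id \<otimes> \<Gamma>\<close> are the unique normal
  homomorphisms on \<open>M \<otimes> M\<close> with the given values on elementary tensors. The maps
  \<open>tL : (H \<otimes> H) \<times> H \<rightarrow> H \<otimes> H \<otimes> H\<close> and \<open>tR : H \<times> (H \<otimes> H) \<rightarrow> H \<otimes> H \<otimes> H\<close> are the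
  two bracketings of the triple tensor product.\<close>

definition coassociative ::
    "('h::complex_hilbert \<Rightarrow> 'h \<Rightarrow> 'h2::complex_hilbert) \<Rightarrow>
     ('h2 \<Rightarrow> 'h \<Rightarrow> 'h3::complex_hilbert) \<Rightarrow> ('h \<Rightarrow> 'h2 \<Rightarrow> 'h3) \<Rightarrow> ('h \<Rightarrow>\<^sub>L 'h) set \<Rightarrow>
     (('h \<Rightarrow>\<^sub>L 'h) \<Rightarrow> ('h2 \<Rightarrow>\<^sub>L 'h2)) \<Rightarrow> bool" where
  "coassociative t tL tR M \<Gamma> \<longleftrightarrow>
     (\<exists>\<Phi> \<Psi>. normal_unital_star_hom (vN_tensor t M M) (vN_tensor tL (vN_tensor t M M) M) \<Phi> \<and>
            normal_unital_star_hom (vN_tensor t M M) (vN_tensor tR M (vN_tensor t M M)) \<Psi> \<and>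
            (\<forall>x\<in>M. \<forall>y\<in>M. \<Phi> (op_tensor t x y) = op_tensor tL (\<Gamma> x) y) \<and>
            (\<forall>x\<in>M. \<forall>y\<in>M. \<Psi> (op_tensor t x y) = op_tensor tR x (\<Gamma> y)) \<and>
            (\<forall>x\<in>M. \<Phi> (\<Gamma> x) = \<Psi> (\<Gamma> x)))"

text \<open>The quantum group \<open>\<GG>\<close> with \<open>M = L\<^sub>\<infinity>(\<GG>)\<close>, realised on \<open>L\<^sub>2(\<GG>)\<close> (the type \<open>'h\<close>), with
  \<open>\<Lambda> = \<Lambda>\<^sub>\<phi>\<close>; \<open>t\<close>, \<open>tL\<close>, \<open>tR\<close> fix a model of the tensor powers of \<open>L\<^sub>2(\<GG>)\<close>.\<close>

locale locally_compact_quantum_group =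
  fixes t :: "'h::complex_hilbert \<Rightarrow> 'h \<Rightarrow> 'h2::complex_hilbert"
    and tL :: "'h2 \<Rightarrow> 'h \<Rightarrow> 'h3::complex_hilbert"
    and tR :: "'h \<Rightarrow> 'h2 \<Rightarrow> 'h3"
    and M :: "('h \<Rightarrow>\<^sub>L 'h) set"
    and \<Gamma> :: "('h \<Rightarrow>\<^sub>L 'h) \<Rightarrow> ('h2 \<Rightarrow>\<^sub>L 'h2)"
    and \<phi> \<psi> :: "('h \<Rightarrow>\<^sub>L 'h) \<Rightarrow> ennreal"
    and \<Lambda> :: "('h \<Rightarrow>\<^sub>L 'h) \<Rightarrow> 'h"
  assumes tensor: "hilbert_tensor t" "hilbert_tensor tL" "hilbert_tensor tR"
    and tensor_assoc: "tL (t a b) c = tR a (t b c)"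
    and von_neumann: "von_neumann_algebra M"
    and comult_hom: "normal_unital_star_hom M (vN_tensor t M M) \<Gamma>"
    and comult_inj: "inj_on \<Gamma> M"
    and comult_coassoc: "coassociative t tL tR M \<Gamma>"
    and left_haar: "nsf_weight M \<phi>" "left_invariant_weight t M \<Gamma> \<phi>"
    and right_haar: "nsf_weight M \<psi>" "right_invariant_weight t M \<Gamma> \<psi>"
    and gns: "GNS_map M \<phi> \<Lambda>"

section \<open>The fundamental unitary, the dual and the action\<close>

text \<open>The graph of the algebraic tensor product \<open>\<Lambda> \<odot> \<Lambda>\<close> on \<open>\<n>\<^sub>\<phi> \<odot> \<n>\<^sub>\<phi>\<close>.\<close>

definition algebraic_GNS_tensor ::
    "('h::complex_hilbert \<Rightarrow> 'h \<Rightarrow> 'h2::complex_hilbert) \<Rightarrow> ('h \<Rightarrow>\<^sub>L 'h) set \<Rightarrow>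
     (('h \<Rightarrow>\<^sub>L 'h) \<Rightarrow> ennreal) \<Rightarrow> (('h \<Rightarrow>\<^sub>L 'h) \<Rightarrow> 'h) \<Rightarrow> (('h2 \<Rightarrow>\<^sub>L 'h2) \<times> 'h2) set" where
  "algebraic_GNS_tensor t M \<phi> \<Lambda> =
     {(\<Sum>i<n. op_tensor t (x i) (y i), \<Sum>i<n. t (\<Lambda> (x i)) (\<Lambda> (y i))) | (n::nat) x y.
        \<forall>i<n. x i \<in> n_ideal M \<phi> \<and> y i \<in> n_ideal M \<phi>}"

text \<open>\<open>GNS_tensor t M \<phi> \<Lambda> X \<zeta>\<close> says that \<open>X \<in> \<n>\<^bsub>\<phi>\<otimes>\<phi>\<^esub>\<close> and \<open>(\<Lambda> \<otimes> \<Lambda>)(X) = \<zeta>\<close>: the GNS map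
  \<open>\<Lambda> \<otimes> \<Lambda>\<close> of the tensor product weight is the closure of \<open>\<Lambda> \<odot> \<Lambda>\<close> for the \<open>\<sigma>\<close>-strong\<open>*\<close>
  topology on \<open>M \<otimes> M\<close> and the norm on \<open>H \<otimes> H\<close>. The square-summable sequences \<open>\<theta>\<close> give the
  seminorms of the \<open>\<sigma>\<close>-strong\<open>*\<close> topology.\<close>

definition GNS_tensor ::
    "('h::complex_hilbert \<Rightarrow> 'h \<Rightarrow> 'h2::complex_hilbert) \<Rightarrow> ('h \<Rightarrow>\<^sub>L 'h) set \<Rightarrow>
     (('h \<Rightarrow>\<^sub>L 'h) \<Rightarrow> ennreal) \<Rightarrow> (('h \<Rightarrow>\<^sub>L 'h) \<Rightarrow> 'h) \<Rightarrow> ('h2 \<Rightarrow>\<^sub>L 'h2) \<Rightarrow> 'h2 \<Rightarrow> bool" where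
  "GNS_tensor t M \<phi> \<Lambda> X \<zeta> \<longleftrightarrow> X \<in> vN_tensor t M M \<and>
     (\<forall>\<theta> \<epsilon>. summable (\<lambda>n::nat. (norm (\<theta> n))\<^sup>2) \<and> \<epsilon> > 0 \<longrightarrow>
        (\<exists>(Y, \<eta>) \<in> algebraic_GNS_tensor t M \<phi> \<Lambda>.
           (\<Sum>n. (norm (blinfun_apply (X - Y) (\<theta> n)))\<^sup>2 +
                 (norm (blinfun_apply (adj (X - Y)) (\<theta> n)))\<^sup>2) < \<epsilon> \<and>
           norm (\<zeta> - \<eta>) < \<epsilon>))"

text \<open>\<open>W\<^sup>*(\<Lambda> x \<otimes> \<Lambda> y) = (\<Lambda> \<otimes> \<Lambda>)(\<Gamma>(y)(x \<otimes> 1))\<close>, which determines \<open>W\<close>.\<close>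

definition left_fundamental_unitary ::
    "('h::complex_hilbert \<Rightarrow> 'h \<Rightarrow> 'h2::complex_hilbert) \<Rightarrow> ('h \<Rightarrow>\<^sub>L 'h) set \<Rightarrow>
     (('h \<Rightarrow>\<^sub>L 'h) \<Rightarrow> ('h2 \<Rightarrow>\<^sub>L 'h2)) \<Rightarrow> (('h \<Rightarrow>\<^sub>L 'h) \<Rightarrow> ennreal) \<Rightarrow> (('h \<Rightarrow>\<^sub>L 'h) \<Rightarrow> 'h) \<Rightarrow>
     ('h2 \<Rightarrow>\<^sub>L 'h2) \<Rightarrow> bool" where
  "left_fundamental_unitary t M \<Gamma> \<phi> \<Lambda> W \<longleftrightarrow> unitary_op W \<and>
     (\<forall>x\<in>n_ideal M \<phi>. \<forall>y\<in>n_ideal M \<phi>.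
        GNS_tensor t M \<phi> \<Lambda> (\<Gamma> y o\<^sub>L op_tensor t x id_blinfun)
          (blinfun_apply (adj W) (t (\<Lambda> x) (\<Lambda> y))))"

text \<open>\<open>L\<^sub>\<infinity>\<close> of the dual, \<open>{(f \<otimes> id)(W) : f \<in> L\<^sub>1(\<GG>)}''\<close>. As \<open>W\<close> lies in the von Neumann tensor
  product of \<open>M\<close> and \<open>\<B>(H)\<close>, \<open>(f \<otimes> id)(W)\<close> may be computed with any normal extension
  \<open>\<omega>\<close> of \<open>f\<close> to \<open>\<B>(H)\<close>.\<close>

definition dual_algebra ::
    "('h::complex_hilbert \<Rightarrow> 'h \<Rightarrow> 'h2::complex_hilbert) \<Rightarrow> ('h \<Rightarrow>\<^sub>L 'h) set \<Rightarrow> ('h2 \<Rightarrow>\<^sub>L 'h2) \<Rightarrow>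
     ('h \<Rightarrow>\<^sub>L 'h) set" where
  "dual_algebra t M W = commutant (commutant
     {slice_left t \<omega> W | f \<omega>. f \<in> predual M \<and> \<omega> \<in> trace_class_functionals \<and> (\<forall>x\<in>M. \<omega> x = f x)})"

text \<open>\<open>x \<lhd> \<omega> = (\<omega> \<otimes> id)(W\<^sup>*(1 \<otimes> x)W)\<close>\<close>

definition module_action ::
    "('h::complex_hilbert \<Rightarrow> 'h \<Rightarrow> 'h2::complex_hilbert) \<Rightarrow> ('h2 \<Rightarrow>\<^sub>L 'h2) \<Rightarrow>
     ('h \<Rightarrow>\<^sub>L 'h) \<Rightarrow> (('h \<Rightarrow>\<^sub>L 'h) \<Rightarrow> complex) \<Rightarrow> ('h \<Rightarrow>\<^sub>L 'h)" where
  "module_action t W x \<omega> = slice_left t \<omega> (adj W o\<^sub>L op_tensor t id_blinfun x o\<^sub>L W)"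

end

theory Submission
  imports Defs
begin

text \<open>
  Write \<open>N\<close> for \<open>L\<^sub>\<infinity>\<close> of the dual. A covariant conditional expectation is in particular a
  conditional expectation, so only one implication has content, and it holds in a strong form:
  \<^emph>\<open>every\<close> norm-one projection \<open>E\<close> of \<open>\<B>(H)\<close> onto \<open>N\<close> is covariant. Morally this is because
  \<open>W\<close> is a unitary of \<open>\<B>(H) \<otimes> N\<close>, \<open>E\<close> is an \<open>N\<close>-bimodule map (Tomiyama), hence
  \<open>id \<otimes> E\<close> is a \<open>\<B>(H) \<otimes> N\<close>-bimodule map, and therefore
  \<open>(id \<otimes> E)(W\<^sup>*(1 \<otimes> x)W) = W\<^sup>*(1 \<otimes> E x)W\<close>; slicing the first leg is the claim. For a
  non-normal \<open>E\<close> the map \<open>id \<otimes> E\<close> needs the theory of completely bounded maps. The proof below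
  replaces it by an inequality that is applied twice.

  Put \<open>V \<xi> b = \<xi> \<otimes> b\<close>, \<open>A x = (V \<xi>)\<^sup>*W\<^sup>*(1 \<otimes> x)W(V \<xi>)\<close> and \<open>a e = (V e)\<^sup>*W(V \<xi>)\<close>, a slice of
  \<open>W\<close>, so that \<open>a e \<in> N\<close>. For \<open>x \<ge> 0\<close>, \<open>A x\<close> is the supremum of the finite sums of
  \<open>(a e)\<^sup>*x(a e)\<close> over orthonormal sets of vectors \<open>e\<close>. As \<open>E\<close> is positive and a bimodule map,
  it follows that \<open>E(A x) \<ge> A(E x)\<close>; normality would give equality at once. Instead apply the
  inequality also to \<open>c - x \<ge> 0\<close>: because \<open>W\<close> is unitary, \<open>A 1\<close> is a scalar, and the two
  inequalities together say \<open>E(A x) = A(E x)\<close> (\<open>E_conj_slice_positive\<close>). Polarization in \<open>\<xi>\<close>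
  gives all vector functionals, and since \<open>E\<close> is norm continuous and a normal functional is a
  norm convergent series of vector functionals, all \<open>\<omega>\<close> (\<open>E_module_action\<close>).

  Two ingredients have to be supplied. The first is Tomiyama's theorem, for which there is a
  proof that uses neither projections nor functional calculus: see the section on it. The second
  is that \<open>N\<close> is closed under adjoints. The slices of \<open>W\<close> are not visibly so, but the range of
  the positive map \<open>E\<close> is (\<open>adj_N\<close>).
\<close>

text \<open>Composition at the precedence of multiplication, for calculations in the ring of
  operators.\<close>

notation blinfun_compose (infixl "\<odot>" 70)

section \<open>Complex Hilbert spaces\<close>

instance complex_hilbert \<subseteq> banach ..

lemma cinner_add_left: "cinner (x + y) z = cinner x z + cinner (y::'a::complex_hilbert) z"
  by (metis cinner_add_right cinner_commute complex_cnj_add)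

lemma cinner_scaleC_left: "cinner (c *\<^sub>C x) y = cnj c * cinner (x::'a::complex_hilbert) y"
  by (metis cinner_commute cinner_scaleC_right complex_cnj_mult)

lemma scaleR_eq_scaleC: "r *\<^sub>R x = complex_of_real r *\<^sub>C (x::'a::complex_hilbert)"
  by (simp add: scaleC_of_real)

lemma cinner_scaleR_left: "cinner (r *\<^sub>R x) y = of_real r * cinner (x::'a::complex_hilbert) y"
  by (simp add: scaleR_eq_scaleC cinner_scaleC_left)

lemma cinner_scaleR_right: "cinner x (r *\<^sub>R y) = of_real r * cinner (x::'a::complex_hilbert) y"
  by (simp add: scaleR_eq_scaleC cinner_scaleC_right)

lemma cinner_zero_left [simp]: "cinner 0 (y::'a::complex_hilbert) = 0"
  using cinner_scaleR_left[of 0 0 y] by simp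

lemma cinner_zero_right [simp]: "cinner (x::'a::complex_hilbert) 0 = 0"
  using cinner_scaleR_right[of x 0 0] by simp

lemma cinner_minus_left: "cinner (- x) y = - cinner (x::'a::complex_hilbert) y"
  using cinner_scaleR_left[of "-1" x y] by simp

lemma cinner_minus_right: "cinner x (- y) = - cinner (x::'a::complex_hilbert) y"
  using cinner_scaleR_right[of x "-1" y] by simp

lemma cinner_diff_left: "cinner (x - y) z = cinner x z - cinner (y::'a::complex_hilbert) z"
  using cinner_add_left[of x "-y" z] by (simp add: cinner_minus_left)

lemma cinner_diff_right: "cinner x (y - z) = cinner x y - cinner (x::'a::complex_hilbert) z"
  using cinner_add_right[of x y "-z"] by (simp add: cinner_minus_right)

lemmas cinner_simps = cinner_add_left cinner_add_right cinner_diff_left cinner_diff_right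
  cinner_minus_left cinner_minus_right cinner_scaleC_left cinner_scaleC_right
  cinner_scaleR_left cinner_scaleR_right

lemma cinner_sum_left: "cinner (\<Sum>i\<in>I. f i) y = (\<Sum>i\<in>I. cinner (f i) (y::'a::complex_hilbert))"
  by (induction I rule: infinite_finite_induct) (auto simp: cinner_add_left)

lemma cinner_sum_right: "cinner y (\<Sum>i\<in>I. f i) = (\<Sum>i\<in>I. cinner (y::'a::complex_hilbert) (f i))"
  by (induction I rule: infinite_finite_induct) (auto simp: cinner_add_right)

lemma cinner_self: "cinner x (x::'a::complex_hilbert) = of_real ((norm x)\<^sup>2)"
proof (rule complex_eqI)
  show "Im (cinner x x) = Im (of_real ((norm x)\<^sup>2))"
    using arg_cong[OF cinner_commute[of x x], of Im] by simp
qed (simp add: Re_cinner dot_square_norm)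

lemma norm_scaleC: "norm (c *\<^sub>C (x::'a::complex_hilbert)) = cmod c * norm x"
proof -
  have "complex_of_real ((norm (c *\<^sub>C x))\<^sup>2) = cnj c * c * of_real ((norm x)\<^sup>2)"
    by (simp only: cinner_self[symmetric] cinner_scaleC_left cinner_scaleC_right) simp
  also have "cnj c * c = of_real ((cmod c)\<^sup>2)"
    by (metis complex_norm_square mult.commute)
  finally have "complex_of_real ((norm (c *\<^sub>C x))\<^sup>2) = of_real ((cmod c * norm x)\<^sup>2)"
    by (simp add: power_mult_distrib)
  then have "(norm (c *\<^sub>C x))\<^sup>2 = (cmod c * norm x)\<^sup>2"
    by (simp only: of_real_eq_iff)
  then show ?thesis by simp
qed

lemma Im_cinner: "Im (cinner x y) = inner (\<i> *\<^sub>C x) (y::'a::complex_hilbert)"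
  by (simp add: Re_cinner[symmetric] cinner_scaleC_left)

text \<open>The real Cauchy-Schwarz inequality, after rotating \<open>y\<close> by a phase that makes the product
  positive.\<close>

lemma norm_cinner_le: "cmod (cinner x y) \<le> norm x * norm (y::'a::complex_hilbert)"
proof (cases "cinner x y = 0")
  case False
  define c where "c = cnj (cinner x y) / of_real (cmod (cinner x y))"
  have "c * cinner x y = of_real (cmod (cinner x y))"
    using False complex_norm_square[of "cinner x y"] by (simp add: c_def field_simps power2_eq_square)
  then have "cmod (cinner x y) = inner x (c *\<^sub>C y)"
    by (metis cinner_scaleC_right Re_cinner Re_complex_of_real)
  also have "\<dots> \<le> norm x * norm (c *\<^sub>C y)"
    by (rule norm_cauchy_schwarz)
  also have "norm (c *\<^sub>C y) = norm y"
    using False by (simp add: norm_scaleC c_def norm_divide)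
  finally show ?thesis .
qed simp

lemma bounded_bilinear_cinner: "bounded_bilinear (cinner :: 'a::complex_hilbert \<Rightarrow> 'a \<Rightarrow> complex)"
proof
  show "\<exists>K. \<forall>a b :: 'a. norm (cinner a b) \<le> norm a * norm b * K"
    by (rule exI[of _ 1]) (simp add: norm_cinner_le)
qed (auto simp: cinner_simps scaleR_conv_of_real)

lemmas continuous_on_cinner [continuous_intros] =
  bounded_bilinear.continuous_on[OF bounded_bilinear_cinner]

lemma bounded_linear_scaleC: "bounded_linear (\<lambda>x::'a::complex_hilbert. c *\<^sub>C x)"
proof
  show "\<exists>K. \<forall>x::'a. norm (c *\<^sub>C x) \<le> norm x * K"
    by (rule exI[of _ "cmod c"]) (simp add: norm_scaleC mult.commute)
qed (auto simp: scaleC_add_right scaleR_eq_scaleC scaleC_scaleC mult.commute)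

lemma scaleC_one [simp]: "1 *\<^sub>C (x::'a::complex_hilbert) = x"
  using scaleC_of_real[of 1 x] by simp

lemma scaleC_zero [simp]: "0 *\<^sub>C (x::'a::complex_hilbert) = 0"
  using scaleC_of_real[of 0 x] by simp

lemma scaleC_minus_left: "(- c) *\<^sub>C x = - (c *\<^sub>C (x::'a::complex_hilbert))"
  using scaleC_add_left[of c "- c" x] by (simp add: eq_neg_iff_add_eq_0 add.commute)

lemma scaleC_diff_right: "c *\<^sub>C (x - y) = c *\<^sub>C x - c *\<^sub>C (y::'a::complex_hilbert)"
  by (rule linear_diff[OF bounded_linear.linear[OF bounded_linear_scaleC]])

lemma scaleC_sum_right: "c *\<^sub>C (\<Sum>i\<in>I. f i) = (\<Sum>i\<in>I. c *\<^sub>C (f i :: 'a::complex_hilbert))"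
  by (rule linear_sum[OF bounded_linear.linear[OF bounded_linear_scaleC]])

lemma cinner_eqI:
  assumes "\<And>z. cinner z x = cinner z (y::'a::complex_hilbert)"
  shows "x = y"
proof -
  have "cinner (x - y) (x - y) = 0"
    using assms[of "x - y"] by (simp add: cinner_diff_right)
  then show ?thesis by (simp add: cinner_self)
qed

text \<open>The representing vector minimises \<open>\<parallel>x\<parallel>\<^sup>2 - 2 f x\<close>. By the parallelogram law a minimising
  sequence is Cauchy, and the first variation at the minimum is the claim.\<close>

lemma riesz_representation:
  fixes f :: "'a::{real_inner,complete_space} \<Rightarrow> real"
  assumes "bounded_linear f"
  obtains y where "\<And>x. f x = inner y x"
proof -
  interpret f: bounded_linear f by fact
  obtain K where K: "\<And>x. \<bar>f x\<bar> \<le> norm x * K" "K \<ge> 0"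
    using f.nonneg_bounded by (auto simp: mult.commute)
  define q where "q x = (norm x)\<^sup>2 - 2 * f x" for x
  have bound: "q x \<ge> - (K\<^sup>2)" for x
  proof -
    have "0 \<le> (norm x - K)\<^sup>2" by simp
    also have "\<dots> = (norm x)\<^sup>2 - 2 * (norm x * K) + K\<^sup>2"
      by (simp add: power2_diff)
    finally show ?thesis using K(1)[of x] unfolding q_def by linarith
  qed
  define m where "m = Inf (range q)"
  have bdd: "bdd_below (range q)"
    using bound by (meson bdd_belowI2)
  have m_le: "m \<le> q x" for x
    unfolding m_def by (rule cINF_lower[OF bdd]) simp
  have "\<exists>x. q x < m + 1 / real (Suc n)" for n
    using cINF_less_iff[OF _ bdd, of "m + 1 / real (Suc n)"] by (auto simp: m_def)
  then obtain X where X: "\<And>n. q (X n) < m + 1 / real (Suc n)" by metis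
  have mid: "(norm (x - y))\<^sup>2 + 4 * m \<le> 2 * q x + 2 * q y" for x y
  proof -
    \<comment> \<open>the parallelogram law, with the values of \<open>q\<close> at the midpoint\<close>
    define z where "z = (1/2) *\<^sub>R (x + y)"
    have "(norm (x - y))\<^sup>2 = 2 * q x + 2 * q y - 4 * q z"
      unfolding q_def z_def
      by (simp add: power2_norm_eq_inner inner_simps f.add f.scaleR inner_commute algebra_simps)
    moreover have "4 * m \<le> 4 * q z" using m_le[of z] by simp
    ultimately show ?thesis by (simp add: algebra_simps)
  qed
  have "Cauchy X"
  proof (rule metric_CauchyI)
    fix e :: real assume "0 < e"
    then have "0 < e\<^sup>2 / 4" by simp
    then obtain N where N: "1 / real (Suc N) < e\<^sup>2 / 4"
      by (rule nat_approx_posE)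
    have "dist (X a) (X b) < e" if "a \<ge> N" "b \<ge> N" for a b
    proof -
      have "1 / real (Suc a) \<le> 1 / real (Suc N)" "1 / real (Suc b) \<le> 1 / real (Suc N)"
        using that by (auto intro!: divide_left_mono)
      then have "(norm (X a - X b))\<^sup>2 < e\<^sup>2"
        using mid[of "X a" "X b"] X[of a] X[of b] N by linarith
      then show ?thesis using \<open>0 < e\<close> by (simp add: dist_norm power2_less_imp_less)
    qed
    then show "\<exists>M. \<forall>a\<ge>M. \<forall>b\<ge>M. dist (X a) (X b) < e" by blast
  qed
  then obtain y where y: "X \<longlonglongrightarrow> y" by (auto simp: Cauchy_convergent_iff convergent_def)
  have "(\<lambda>n. q (X n)) \<longlonglongrightarrow> q y"
    unfolding q_def by (intro tendsto_intros y f.tendsto)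
  moreover have "(\<lambda>n. m + 1 / real (Suc n)) \<longlonglongrightarrow> m + 0"
    by (intro tendsto_intros LIMSEQ_Suc[OF lim_1_over_n])
  ultimately have "q y \<le> m + 0"
    using X by (intro LIMSEQ_le[of "\<lambda>n. q (X n)" _ "\<lambda>n. m + 1 / real (Suc n)"]) (auto intro: less_imp_le)
  then have min: "q y \<le> q z" for z using m_le[of z] by linarith
  have "f x = inner y x" for x
  proof -
    define c where "c = inner y x - f x"
    have *: "0 \<le> 2 * s * c + s * s * (norm x)\<^sup>2" for s
    proof -
      have "q (y + s *\<^sub>R x) - q y = 2 * s * c + s * s * (norm x)\<^sup>2"
        unfolding q_def c_def
        by (simp add: power2_norm_eq_inner inner_simps f.add f.scaleR inner_commute algebra_simps)
      then show ?thesis using min[of "y + s *\<^sub>R x"] by linarith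
    qed
    have "c = 0"
    proof (cases "x = 0")
      case False
      then have "0 \<le> - (c\<^sup>2 / (norm x)\<^sup>2)"
        using *[of "- c / (norm x)\<^sup>2"] by (simp add: field_simps power2_eq_square)
      then have "c\<^sup>2 / (norm x)\<^sup>2 \<le> 0" by linarith
      then show ?thesis using False by (simp add: divide_le_0_iff)
    qed (simp add: c_def f.zero)
    then show ?thesis by (simp add: c_def)
  qed
  then show thesis by (rule that)
qed

section \<open>Bounded operators and their adjoints\<close>

lemma BH_scaleC: "T \<in> BH \<Longrightarrow> T (c *\<^sub>C x) = c *\<^sub>C T x"
  by (simp add: BH_def)

lemma BH_id [simp]: "id_blinfun \<in> BH"
  by (simp add: BH_def)

lemma BH_zero [simp]: "0 \<in> BH"
  by (simp add: BH_def bounded_linear.linear[OF bounded_linear_scaleC] linear_0)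

lemma BH_add [simp]: "S \<in> BH \<Longrightarrow> T \<in> BH \<Longrightarrow> S + T \<in> BH"
  by (simp add: BH_def blinfun.add_left scaleC_add_right)

lemma BH_diff [simp]: "S \<in> BH \<Longrightarrow> T \<in> BH \<Longrightarrow> S - T \<in> BH"
  by (simp add: BH_def blinfun.diff_left scaleC_diff_right)

lemma BH_compose [simp]: "S \<in> BH \<Longrightarrow> T \<in> BH \<Longrightarrow> S \<odot> T \<in> BH"
  by (simp add: BH_def)

lemma scale_op_apply [simp]: "scale_op c T x = c *\<^sub>C T x"
  unfolding scale_op_def
  by (subst bounded_linear_Blinfun_apply)
     (auto intro: bounded_linear_compose[OF bounded_linear_scaleC] blinfun.bounded_linear_right)

lemma BH_scale_op [simp]: "T \<in> BH \<Longrightarrow> scale_op c T \<in> BH"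
  by (simp add: BH_def scaleC_scaleC mult.commute)

lemma scaleR_eq_scale_op: "r *\<^sub>R T = scale_op (of_real r) T"
  by (rule blinfun_eqI) (simp add: scaleR_eq_scaleC blinfun.scaleR_left)

lemma BH_scaleR [simp]: "T \<in> BH \<Longrightarrow> r *\<^sub>R T \<in> BH"
  by (simp add: scaleR_eq_scale_op)

lemma BH_uminus [simp]: "T \<in> BH \<Longrightarrow> - T \<in> BH"
  using BH_scaleR[of T "-1"] by simp

lemma BH_sum [simp]: "(\<And>i. i \<in> I \<Longrightarrow> T i \<in> BH) \<Longrightarrow> (\<Sum>i\<in>I. T i) \<in> BH"
  by (induction I rule: infinite_finite_induct) auto

lemma BH_suminf:
  assumes "summable T" "\<And>n. T n \<in> BH"
  shows "suminf T \<in> BH"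
proof -
  have S: "T sums suminf T" using assms(1) by (rule summable_sums)
  have "suminf T (c *\<^sub>C x) = c *\<^sub>C suminf T x" for c x
  proof -
    have "(\<lambda>n. T n (c *\<^sub>C x)) sums (suminf T (c *\<^sub>C x))"
      by (rule bounded_linear.sums[OF blinfun.bounded_linear_left S])
    moreover have "(\<lambda>n. c *\<^sub>C T n x) sums (c *\<^sub>C suminf T x)"
      by (intro bounded_linear.sums[OF bounded_linear_scaleC]
            bounded_linear.sums[OF blinfun.bounded_linear_left S])
    ultimately show ?thesis using assms(2) by (simp add: BH_scaleC sums_unique2)
  qed
  then show ?thesis by (simp add: BH_def)
qed

text \<open>The Riesz theorem for the real inner product yields a real adjoint; testing it on
  \<open>\<i> x\<close> recovers the imaginary part of the complex inner product.\<close>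

lemma adj_exists:
  assumes "T \<in> BH"
  shows "\<exists>!S. S \<in> BH \<and> (\<forall>x y. cinner (blinfun_apply T x) y = cinner x (blinfun_apply S y))"
proof (rule ex_ex1I)
  have "\<exists>s. \<forall>x. inner y (T x) = inner s x" for y
    by (rule riesz_representation[of "\<lambda>x. inner y (T x)"])
       (auto intro: bounded_linear_compose[OF bounded_linear_inner_right] blinfun.bounded_linear_right)
  then obtain S where S: "\<And>x y. inner y (T x) = inner (S y) x" by metis
  have c: "cinner x (S y) = cinner (T x) y" for x y
  proof (rule complex_eqI)
    show "Re (cinner x (S y)) = Re (cinner (T x) y)"
      using S[of y x] by (simp add: Re_cinner inner_commute)
    show "Im (cinner x (S y)) = Im (cinner (T x) y)"
      using S[of y "\<i> *\<^sub>C x"] by (simp add: Im_cinner inner_commute BH_scaleC[OF assms])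
  qed
  have add: "S (x + y) = S x + S y" for x y
    by (rule cinner_eqI) (simp add: cinner_add_right c)
  have scl: "S (a *\<^sub>C x) = a *\<^sub>C S x" for a x
    by (rule cinner_eqI) (simp add: cinner_scaleC_right c)
  have bnd: "norm (S y) \<le> norm y * norm T" for y
  proof -
    have "(norm (S y))\<^sup>2 = Re (cinner (T (S y)) y)"
      by (simp add: c[symmetric] cinner_self)
    also have "\<dots> \<le> norm (T (S y)) * norm y"
      using complex_Re_le_cmod norm_cinner_le order_trans by blast
    also have "\<dots> \<le> norm T * norm (S y) * norm y"
      by (intro mult_right_mono norm_blinfun) auto
    finally have "norm (S y) * norm (S y) \<le> norm (S y) * (norm y * norm T)"
      by (simp add: power2_eq_square mult_ac)
    then show ?thesis
      by (cases "S y = 0") auto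
  qed
  have "bounded_linear S"
    by (rule bounded_linear_intro[of _ "norm T"])
       (simp_all add: add scl bnd scaleR_eq_scaleC)
  then have "blinfun_apply (Blinfun S) = S" by (rule bounded_linear_Blinfun_apply)
  then show "\<exists>S. S \<in> BH \<and> (\<forall>x y. cinner (blinfun_apply T x) y = cinner x (blinfun_apply S y))"
    by (intro exI[of _ "Blinfun S"]) (simp add: BH_def scl c)
next
  fix S S' :: "'b \<Rightarrow>\<^sub>L 'a"
  assume "S \<in> BH \<and> (\<forall>x y. cinner (blinfun_apply T x) y = cinner x (blinfun_apply S y))"
    and "S' \<in> BH \<and> (\<forall>x y. cinner (blinfun_apply T x) y = cinner x (blinfun_apply S' y))"
  then have "cinner x (S y) = cinner (T x) y" "cinner x (S' y) = cinner (T x) y" for x y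
    by simp_all
  then show "S = S'"
    by (intro blinfun_eqI cinner_eqI) simp
qed

lemma adj_BH [simp]: "T \<in> BH \<Longrightarrow> adj T \<in> BH"
  using theI'[OF adj_exists[of T]] unfolding adj_def by (rule conjunct1)

lemma cinner_adj_right: "T \<in> BH \<Longrightarrow> cinner x (adj T y) = cinner (T x) y"
  using theI'[OF adj_exists[of T], THEN conjunct2, rule_format, of x y] unfolding adj_def by (rule sym)

lemma cinner_adj_left: "T \<in> BH \<Longrightarrow> cinner (adj T x) y = cinner x (T y)"
  by (metis cinner_adj_right cinner_commute)

lemma adj_eqI:
  assumes "T \<in> BH" "S \<in> BH" "\<And>x y. cinner (T x) y = cinner x (S y)"
  shows "adj T = S"
  by (rule blinfun_eqI, rule cinner_eqI) (simp add: cinner_adj_right assms)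

lemma adj_adj [simp]: "T \<in> BH \<Longrightarrow> adj (adj T) = T"
  by (rule adj_eqI) (simp_all add: cinner_adj_left)

lemma adj_compose: "S \<in> BH \<Longrightarrow> T \<in> BH \<Longrightarrow> adj (S \<odot> T) = adj T \<odot> adj S"
  by (rule adj_eqI) (simp_all add: cinner_adj_right)

lemma adj_add: "S \<in> BH \<Longrightarrow> T \<in> BH \<Longrightarrow> adj (S + T) = adj S + adj T"
  by (rule adj_eqI) (simp_all add: cinner_adj_right cinner_simps blinfun.add_left)

lemma adj_diff: "S \<in> BH \<Longrightarrow> T \<in> BH \<Longrightarrow> adj (S - T) = adj S - adj T"
  by (rule adj_eqI) (simp_all add: cinner_adj_right cinner_simps blinfun.diff_left)

lemma adj_scale_op: "T \<in> BH \<Longrightarrow> adj (scale_op c T) = scale_op (cnj c) (adj T)"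
  by (rule adj_eqI) (simp_all add: cinner_adj_right cinner_simps)

lemma norm_adj_le:
  assumes "T \<in> BH"
  shows "norm (adj T) \<le> norm T"
proof (rule norm_blinfun_bound)
  fix y
  have "(norm (adj T y))\<^sup>2 = Re (cinner (T (adj T y)) y)"
    by (simp add: cinner_adj_right[OF assms, symmetric] cinner_self)
  also have "\<dots> \<le> norm (T (adj T y)) * norm y"
    using complex_Re_le_cmod norm_cinner_le order_trans by blast
  also have "\<dots> \<le> norm T * norm (adj T y) * norm y"
    by (intro mult_right_mono norm_blinfun) auto
  finally have "norm (adj T y) * norm (adj T y) \<le> norm (adj T y) * (norm T * norm y)"
    by (simp add: power2_eq_square mult_ac)
  then show "norm (adj T y) \<le> norm T * norm y"
    by (cases "adj T y = 0") auto
qed simp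

text \<open>Complex polarization: the quadratic form at \<open>z + x\<close> gives the sum of the two mixed terms and
  at \<open>z + \<i> x\<close> their difference.\<close>

lemma op_eqI_quadratic:
  assumes "T \<in> BH" "S \<in> BH" "\<And>h. cinner h (T h) = cinner h (S h)"
  shows "T = (S :: 'a::complex_hilbert \<Rightarrow>\<^sub>L 'a)"
proof (rule blinfun_eqI, rule cinner_eqI)
  fix x z
  define B where "B a b = cinner a (T b) - cinner a (S b)" for a b
  have diag: "B a a = 0" for a by (simp add: B_def assms)
  have "B (z + x) (z + x) = B z z + B z x + B x z + B x x"
    by (simp add: B_def blinfun.add_right cinner_simps)
  then have 1: "B z x + B x z = 0" by (simp add: diag)
  have "B (z + \<i> *\<^sub>C x) (z + \<i> *\<^sub>C x) = B z z + \<i> * B z x - \<i> * B x z + B x x"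
    by (simp add: B_def blinfun.add_right cinner_simps BH_scaleC assms algebra_simps)
  then have 2: "\<i> * (B z x - B x z) = 0" by (simp add: diag algebra_simps)
  from 1 2 have "B z x = 0" by (simp add: eq_neg_iff_add_eq_0)
  then show "cinner z (T x) = cinner z (S x)" by (simp add: B_def)
qed

lemma compose_assoc: "(R \<odot> S) \<odot> T = R \<odot> (S \<odot> T)"
  by (rule blinfun_eqI) simp

lemmas compose_distribs =
  bounded_bilinear.add_left[OF bounded_bilinear_blinfun_compose]
  bounded_bilinear.add_right[OF bounded_bilinear_blinfun_compose]
  bounded_bilinear.diff_left[OF bounded_bilinear_blinfun_compose]
  bounded_bilinear.diff_right[OF bounded_bilinear_blinfun_compose]
  bounded_bilinear.minus_left[OF bounded_bilinear_blinfun_compose]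
  bounded_bilinear.minus_right[OF bounded_bilinear_blinfun_compose]
  bounded_bilinear.scaleR_left[OF bounded_bilinear_blinfun_compose]
  bounded_bilinear.scaleR_right[OF bounded_bilinear_blinfun_compose]
  bounded_bilinear.zero_left[OF bounded_bilinear_blinfun_compose]
  bounded_bilinear.zero_right[OF bounded_bilinear_blinfun_compose]

lemma compose_id [simp]: "T \<odot> id_blinfun = T" "id_blinfun \<odot> T = T"
  by (auto intro: blinfun_eqI)

lemma compose_scale_op:
  "scale_op c S \<odot> T = scale_op c (S \<odot> T)"
  "S \<in> BH \<Longrightarrow> S \<odot> scale_op c T = scale_op c (S \<odot> T)"
  by (auto intro!: blinfun_eqI simp: BH_scaleC)

lemma scale_op_add: "scale_op c (S + T) = scale_op c S + scale_op c T"
  by (rule blinfun_eqI) (simp add: blinfun.add_left scaleC_add_right)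

lemma scale_op_diff: "scale_op c (S - T) = scale_op c S - scale_op c T"
  by (rule blinfun_eqI) (simp add: blinfun.diff_left scaleC_diff_right)

lemma scale_op_minus: "scale_op (- c) T = - scale_op c T"
  by (rule blinfun_eqI) (simp add: blinfun.minus_left scaleC_minus_left)

lemma scale_op_zero [simp]: "scale_op c 0 = 0"
  by (rule blinfun_eqI)
     (simp add: bounded_linear.linear[OF bounded_linear_scaleC] linear_0)

section \<open>Self-adjoint and positive operators\<close>

definition selfadjoint :: "('a::complex_hilbert \<Rightarrow>\<^sub>L 'a) \<Rightarrow> bool" where
  "selfadjoint T \<longleftrightarrow> T \<in> BH \<and> adj T = T"

lemma selfadjointI:
  assumes "T \<in> BH" "\<And>h. Im (cinner h (T h)) = 0"
  shows "selfadjoint T"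
proof -
  have "cinner h (adj T h) = cinner h (T h)" for h
    using assms(2)[of h]
    by (simp add: cinner_adj_right[OF assms(1)] cinner_commute[of "T h" h] complex_eq_iff)
  then show ?thesis
    using assms(1) by (simp add: selfadjoint_def op_eqI_quadratic)
qed

lemma selfadjoint_BH: "selfadjoint T \<Longrightarrow> T \<in> BH"
  by (simp add: selfadjoint_def)

lemma selfadjoint_cinner: "selfadjoint T \<Longrightarrow> cinner (T x) y = cinner x (T y)"
  by (metis cinner_adj_right selfadjoint_def)

lemma selfadjoint_Im: "selfadjoint T \<Longrightarrow> Im (cinner h (T h)) = 0"
  using arg_cong[OF cinner_commute[of h "T h"], of Im] by (simp add: selfadjoint_cinner)

lemma cartesian_decomposition:
  assumes "x \<in> BH"
  obtains a b where "selfadjoint a" "selfadjoint b" "x = a + scale_op \<i> b"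
    "a = (1/2) *\<^sub>R (x + adj x)" "b = scale_op (- (\<i>/2)) (x - adj x)"
proof (rule that)
  show "selfadjoint ((1/2) *\<^sub>R (x + adj x))"
    using assms by (simp add: selfadjoint_def scaleR_eq_scale_op adj_scale_op adj_add add.commute)
  \<comment> \<open>the left-hand side is the form in which the adjoint of the imaginary part arises\<close>
  have "scale_op (\<i>/2) (adj x - x) = scale_op (- (\<i>/2)) (x - adj x)"
    by (simp add: scale_op_minus scale_op_diff)
  then show "selfadjoint (scale_op (- (\<i>/2)) (x - adj x))"
    using assms by (simp add: selfadjoint_def adj_scale_op adj_diff)
  show "x = (1/2) *\<^sub>R (x + adj x) + scale_op \<i> (scale_op (- (\<i>/2)) (x - adj x))"
  proof -
    have "scale_op \<i> (scale_op (- (\<i>/2)) (x - adj x)) = (1/2) *\<^sub>R (x - adj x)"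
      by (rule blinfun_eqI) (simp add: scaleC_scaleC scaleR_eq_scaleC blinfun.scaleR_left)
    moreover have "(1/2) *\<^sub>R (x + adj x) + (1/2) *\<^sub>R (x - adj x) = x"
      by (simp add: scaleR_add_right[symmetric] scaleR_2[symmetric])
    ultimately show ?thesis by (simp only:)
  qed
qed (rule refl)+

text \<open>Reduces statements about quadratic forms to unit vectors.\<close>

lemma cinner_sgn: "T \<in> BH \<Longrightarrow> cinner h (T h) = of_real ((norm h)\<^sup>2) * cinner (sgn h) (T (sgn h))"
proof -
  assume T: "T \<in> BH"
  have e: "norm h *\<^sub>R sgn h = h" by (cases "h = 0") (simp_all add: sgn_div_norm)
  have "cinner (norm h *\<^sub>R sgn h) (T (norm h *\<^sub>R sgn h)) = of_real ((norm h)\<^sup>2) * cinner (sgn h) (T (sgn h))"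
    by (simp only: blinfun.scaleR_right cinner_simps power2_eq_square of_real_mult mult.assoc)
  then show ?thesis by (simp only: e)
qed

text \<open>The form in which first-order information is extracted from a norm estimate: both signs of
  \<open>\<epsilon>\<close> are allowed, so the linear term must vanish.\<close>

lemma quadratic_bound_zero:
  fixes c K :: real
  assumes "\<And>\<epsilon>. \<epsilon> * c \<le> \<epsilon>\<^sup>2 * K"
  shows "c = 0"
proof -
  define L where "L = \<bar>K\<bar> + 1"
  have L: "L > 0" "K < L" by (auto simp: L_def)
  \<comment> \<open>for \<open>c \<noteq> 0\<close> this value of \<open>\<epsilon>\<close> makes the linear term win\<close>
  have "c / L * c \<le> (c / L)\<^sup>2 * K" by (rule assms)
  then have "c\<^sup>2 * L \<le> c\<^sup>2 * K" using L by (simp add: field_simps power2_eq_square)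
  then show "c = 0" using L by (cases "c = 0") simp_all
qed

text \<open>The cross terms cancel because \<open>\<langle>k, x k\<rangle>\<close> is real. Thus \<open>1 + \<i> \<epsilon> x\<close> is bounded below by
  \<open>1\<close> and its norm is \<open>1\<close> up to second order in \<open>\<epsilon>\<close>, which lets it stand in for the unitary
  \<open>exp (\<i> \<epsilon> x)\<close>.\<close>

lemma norm_add_i_selfadjoint:
  assumes "selfadjoint x"
  shows "(norm (k + scale_op (\<i> * of_real \<epsilon>) x k))\<^sup>2 = (norm k)\<^sup>2 + \<epsilon>\<^sup>2 * (norm (x k))\<^sup>2"
proof -
  define z where "z = k + scale_op (\<i> * of_real \<epsilon>) x k"
  have "cinner z z = cinner k k + of_real (\<epsilon>\<^sup>2) * cinner (x k) (x k)"
    by (simp add: z_def cinner_simps selfadjoint_cinner[OF assms] algebra_simps power2_eq_square)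
  then have "complex_of_real ((norm z)\<^sup>2) = of_real ((norm k)\<^sup>2 + \<epsilon>\<^sup>2 * (norm (x k))\<^sup>2)"
    by (simp add: cinner_self)
  then show ?thesis unfolding z_def by (simp only: of_real_eq_iff)
qed

lemma positive_op_selfadjoint: "positive_op x \<Longrightarrow> selfadjoint x"
  by (rule selfadjointI) (auto simp: positive_op_def)

text \<open>Nonnegativity of the form of \<open>x\<close> at the vector \<open>k - s x k\<close>, where \<open>s = 1 / \<parallel>x\<parallel>\<close> is the
  optimal choice.\<close>

lemma positive_op_norm_sq_le:
  assumes "positive_op x"
  shows "(norm (x k))\<^sup>2 \<le> norm x * Re (cinner k (x k))"
proof (cases "norm x = 0")
  case False
  then have X: "norm x > 0" by simp
  have sa: "selfadjoint x" by (rule positive_op_selfadjoint) fact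
  have 0: "0 \<le> Re (cinner y (x y))" for y using assms by (simp add: positive_op_def)
  define s where "s = 1 / norm x"
  have "Re (cinner (k - s *\<^sub>R x k) (x (k - s *\<^sub>R x k))) =
    Re (cinner k (x k)) - 2 * s * (norm (x k))\<^sup>2 + s\<^sup>2 * Re (cinner (x k) (x (x k)))"
  proof -
    have xx: "cinner k (x (x k)) = of_real ((norm (x k))\<^sup>2)"
      using selfadjoint_cinner[OF sa, of k "x k"] by (simp add: cinner_self)
    have "cinner (k - s *\<^sub>R x k) (x (k - s *\<^sub>R x k)) =
      cinner k (x k) - of_real s * cinner k (x (x k)) - of_real s * cinner (x k) (x k)
        + of_real s * (of_real s * cinner (x k) (x (x k)))"
      by (simp add: blinfun.diff_right blinfun.scaleR_right cinner_simps right_diff_distrib)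
    then show ?thesis
      by (simp add: xx cinner_self power2_eq_square[of s])
  qed
  moreover have "Re (cinner (x k) (x (x k))) \<le> norm x * (norm (x k))\<^sup>2"
  proof -
    have "Re (cinner (x k) (x (x k))) \<le> norm (x k) * norm (x (x k))"
      using complex_Re_le_cmod norm_cinner_le order_trans by blast
    also have "\<dots> \<le> norm (x k) * (norm x * norm (x k))"
      by (intro mult_left_mono norm_blinfun) auto
    finally show ?thesis by (simp add: power2_eq_square mult_ac)
  qed
  then have "s\<^sup>2 * Re (cinner (x k) (x (x k))) \<le> s\<^sup>2 * (norm x * (norm (x k))\<^sup>2)"
    by (rule mult_left_mono) simp
  moreover have "s\<^sup>2 * (norm x * (norm (x k))\<^sup>2) = s * (norm (x k))\<^sup>2"
    using X by (simp add: s_def power2_eq_square)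
  ultimately have "s * (norm (x k))\<^sup>2 \<le> Re (cinner k (x k))"
    using 0[of "k - s *\<^sub>R x k"] by linarith
  then show ?thesis using X by (simp add: s_def field_simps)
qed simp

lemma double_cancel: "X + X = Y + Y \<Longrightarrow> X = (Y::'b::real_vector)"
  by (metis scaleR_2 scaleR_left_imp_eq zero_neq_numeral)

section \<open>Projections of norm one\<close>

text \<open>A projection of norm one onto a unital algebra of operators. Closure of the range under sums,
  scalar multiples and adjoints is a consequence of properties of \<open>E\<close>.\<close>

locale norm_one_projection =
  fixes N :: "('h::complex_hilbert \<Rightarrow>\<^sub>L 'h) set" and E
  assumes cond_exp: "conditional_expectation N E"
    and N_subset_BH: "N \<subseteq> BH"
    and id_N [simp]: "id_blinfun \<in> N"
    and compose_N [simp]: "a \<in> N \<Longrightarrow> b \<in> N \<Longrightarrow> a \<odot> b \<in> N"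
begin

lemma N_BH [simp]: "a \<in> N \<Longrightarrow> a \<in> BH"
  using N_subset_BH by blast

lemma E_add: "x \<in> BH \<Longrightarrow> y \<in> BH \<Longrightarrow> E (x + y) = E x + E y"
  using cond_exp by (simp add: conditional_expectation_def)

lemma E_scale: "x \<in> BH \<Longrightarrow> E (scale_op c x) = scale_op c (E x)"
  using cond_exp by (simp add: conditional_expectation_def)

lemma E_in_N [simp]: "x \<in> BH \<Longrightarrow> E x \<in> N"
  using cond_exp by (auto simp: conditional_expectation_def)

lemma E_fix [simp]: "x \<in> N \<Longrightarrow> E x = x"
  using cond_exp by (simp add: conditional_expectation_def)

lemma norm_E_le: "x \<in> BH \<Longrightarrow> norm (E x) \<le> norm x"
  using cond_exp by (simp add: conditional_expectation_def)

lemma E_scaleR: "x \<in> BH \<Longrightarrow> E (r *\<^sub>R x) = r *\<^sub>R E x"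
  by (simp add: scaleR_eq_scale_op E_scale)

lemma E_diff: "x \<in> BH \<Longrightarrow> y \<in> BH \<Longrightarrow> E (x - y) = E x - E y"
  using E_add[of x "-1 *\<^sub>R y"] E_scaleR[of y "-1"] by simp

lemma E_zero [simp]: "E 0 = 0"
  using E_scaleR[of 0 0] by simp

lemma E_sum: "(\<And>i. i \<in> I \<Longrightarrow> f i \<in> BH) \<Longrightarrow> E (\<Sum>i\<in>I. f i) = (\<Sum>i\<in>I. E (f i))"
  by (induction I rule: infinite_finite_induct) (auto simp: E_add)

lemma add_N [simp]: "a \<in> N \<Longrightarrow> b \<in> N \<Longrightarrow> a + b \<in> N"
  by (metis E_add E_fix E_in_N BH_add N_BH)

lemma scale_op_N [simp]: "a \<in> N \<Longrightarrow> scale_op c a \<in> N"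
  by (metis E_scale E_fix E_in_N BH_scale_op N_BH)

lemma diff_N [simp]: "a \<in> N \<Longrightarrow> b \<in> N \<Longrightarrow> a - b \<in> N"
  by (metis E_diff E_fix E_in_N BH_diff N_BH)

lemma scaleR_N [simp]: "a \<in> N \<Longrightarrow> r *\<^sub>R a \<in> N"
  by (simp add: scaleR_eq_scale_op)

text \<open>Contractivity of \<open>E\<close> at the element \<open>v (1 - \<i> \<epsilon> x)\<close>, whose image is
  \<open>v - \<i> \<epsilon> E (v x)\<close> because \<open>v \<in> N\<close>. When \<open>v\<close> is nearly unitary, the right-hand side is, for
  unit vectors \<open>h\<close>, small of second order in \<open>\<epsilon>\<close>, so the estimate controls \<open>Im \<langle>v h, E (v x) h\<rangle>\<close>.\<close>

lemma E_perturbation_bound: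
  assumes v: "v \<in> N" "(norm v)\<^sup>2 \<le> Q" and x: "selfadjoint x" and h: "norm h = 1"
  shows "\<epsilon> * Im (cinner (v h) (E (v \<odot> x) h)) \<le> Q * (1 + \<epsilon>\<^sup>2 * (norm x)\<^sup>2 / 2) - (norm (v h))\<^sup>2"
proof -
  note xBH = selfadjoint_BH[OF x]
  define R where "R = 1 + \<epsilon>\<^sup>2 * (norm x)\<^sup>2 / 2"
  have R: "R \<ge> 0" by (simp add: R_def)
  define u where "u = id_blinfun + scale_op (\<i> * of_real (- \<epsilon>)) x"
  have u: "norm u \<le> R"
  proof (rule norm_blinfun_bound[OF R])
    fix k
    have "(norm (u k))\<^sup>2 = (norm k)\<^sup>2 + \<epsilon>\<^sup>2 * (norm (x k))\<^sup>2"
      using norm_add_i_selfadjoint[OF x, of k "- \<epsilon>"] by (simp add: u_def blinfun.add_left)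
    also have "\<dots> \<le> (norm k)\<^sup>2 + \<epsilon>\<^sup>2 * (norm x * norm k)\<^sup>2"
      by (intro add_left_mono mult_left_mono power_mono norm_blinfun) auto
    also have "\<dots> \<le> (R * norm k)\<^sup>2"
    proof -
      have "(R * norm k)\<^sup>2 = (norm k)\<^sup>2 + \<epsilon>\<^sup>2 * (norm x * norm k)\<^sup>2 + (\<epsilon>\<^sup>2 * (norm x)\<^sup>2 / 2 * norm k)\<^sup>2"
        by (simp add: R_def power2_eq_square field_simps)
      then show ?thesis by simp
    qed
    finally show "norm (u k) \<le> R * norm k"
      by (rule power2_le_imp_le) (use R in simp)
  qed
  have Evu: "E (v \<odot> u) = v + scale_op (\<i> * of_real (- \<epsilon>)) (E (v \<odot> x))"
    using v xBH by (simp add: u_def compose_distribs compose_scale_op E_add E_scale)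
  have "(norm (v h))\<^sup>2 + \<epsilon> * Im (cinner (v h) (E (v \<odot> x) h)) = Re (cinner (v h) (E (v \<odot> u) h))"
    by (simp add: Evu blinfun.add_left cinner_simps cinner_self)
  also have "\<dots> \<le> norm (v h) * norm (E (v \<odot> u) h)"
    using complex_Re_le_cmod norm_cinner_le order_trans by blast
  also have "\<dots> \<le> norm v * (norm v * R)"
  proof (rule mult_mono)
    show "norm (v h) \<le> norm v" using norm_blinfun[of v h] h by simp
    have "norm (E (v \<odot> u) h) \<le> norm (E (v \<odot> u))"
      using norm_blinfun[of "E (v \<odot> u)" h] h by simp
    also have "\<dots> \<le> norm (v \<odot> u)" using v xBH by (intro norm_E_le) (simp add: u_def)
    also have "\<dots> \<le> norm v * norm u" by (rule norm_blinfun_compose)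
    also have "\<dots> \<le> norm v * R" using u by (rule mult_left_mono) simp
    finally show "norm (E (v \<odot> u) h) \<le> norm v * R" .
  qed (use R in auto)
  also have "\<dots> = (norm v)\<^sup>2 * R" by (simp add: power2_eq_square)
  also have "\<dots> \<le> Q * R" using v(2) R by (rule mult_right_mono)
  finally show ?thesis unfolding R_def by linarith
qed

text \<open>The case \<open>v = 1\<close> of the perturbation bound.\<close>

lemma E_selfadjoint:
  assumes "selfadjoint x"
  shows "selfadjoint (E x)"
proof (rule selfadjointI)
  note xBH [simp] = selfadjoint_BH[OF assms]
  show "E x \<in> BH" by simp
  fix h
  show "Im (cinner h (E x h)) = 0"
  proof (cases "h = 0")
    case False
    have "Im (cinner (sgn h) (E x (sgn h))) = 0"
    proof (rule quadratic_bound_zero)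
      fix \<epsilon>
      have "(norm (id_blinfun :: 'h \<Rightarrow>\<^sub>L 'h))\<^sup>2 \<le> 1"
        by (intro power_le_one norm_blinfun_id_le norm_ge_zero)
      then show "\<epsilon> * Im (cinner (sgn h) (E x (sgn h))) \<le> \<epsilon>\<^sup>2 * ((norm x)\<^sup>2 / 2)"
        using E_perturbation_bound[OF id_N _ assms, of 1 "sgn h" \<epsilon>] False
        by (simp add: norm_sgn)
    qed
    then show ?thesis by (subst cinner_sgn) simp_all
  qed simp
qed

lemma E_adj:
  assumes "x \<in> BH"
  shows "E (adj x) = adj (E x)"
proof -
  obtain a b where ab: "selfadjoint a" "selfadjoint b" "x = a + scale_op \<i> b"
    using cartesian_decomposition[OF assms] by metis
  note [simp] = ab(1,2)[THEN selfadjoint_BH]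
  have "adj a = a" "adj b = b" "adj (E a) = E a" "adj (E b) = E b"
    using ab E_selfadjoint by (auto simp: selfadjoint_def)
  then show ?thesis
    by (simp add: ab(3) adj_add adj_scale_op E_add E_scale)
qed

lemma adj_N [simp]: "a \<in> N \<Longrightarrow> adj a \<in> N"
  by (metis E_adj E_fix E_in_N adj_BH N_BH)

text \<open>If \<open>x \<ge> 0\<close> and \<open>s = 1 / \<parallel>x\<parallel>\<close>, then \<open>1 - s x\<close> is a contraction; hence so is \<open>1 - s E x\<close>.\<close>

lemma E_positive:
  assumes "positive_op x"
  shows "positive_op (E x)"
proof -
  have sa: "selfadjoint x" by (rule positive_op_selfadjoint) fact
  note [simp] = selfadjoint_BH[OF sa]
  have "0 \<le> Re (cinner h (E x h))" for h
  proof (cases "h = 0 \<or> norm x = 0")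
    case True
    then show ?thesis by auto
  next
    case False
    then have X: "norm x > 0" by simp
    define s where "s = 1 / norm x"
    define u where "u = id_blinfun - s *\<^sub>R x"
    have "norm u \<le> 1"
    proof (rule norm_blinfun_bound)
      fix k
      have "(norm (u k))\<^sup>2 = (norm k)\<^sup>2 - 2 * s * Re (cinner k (x k)) + s\<^sup>2 * (norm (x k))\<^sup>2"
        by (simp add: u_def blinfun.diff_left blinfun.scaleR_left power2_norm_eq_inner inner_simps
            Re_cinner inner_commute[of "x k" k] power2_eq_square[of s] algebra_simps)
      also have "s\<^sup>2 * (norm (x k))\<^sup>2 \<le> s\<^sup>2 * (norm x * Re (cinner k (x k)))"
        by (intro mult_left_mono positive_op_norm_sq_le assms) simp
      also have "s\<^sup>2 * (norm x * Re (cinner k (x k))) = s * Re (cinner k (x k))"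
        using X by (simp add: s_def power2_eq_square)
      finally have "(norm (u k))\<^sup>2 \<le> (norm k)\<^sup>2 - s * Re (cinner k (x k))" by linarith
      also have "\<dots> \<le> (norm k)\<^sup>2"
        using X assms by (simp add: s_def positive_op_def)
      finally have "norm (u k) \<le> norm k" by (rule power2_le_imp_le) simp
      then show "norm (u k) \<le> 1 * norm k" by simp
    qed simp
    define e where "e = sgn h"
    have e: "norm e = 1" using False by (simp add: e_def norm_sgn)
    have "Re (cinner e (E u e)) \<le> norm e * norm (E u e)"
      using complex_Re_le_cmod norm_cinner_le order_trans by blast
    also have "\<dots> \<le> norm (E u)" using norm_blinfun[of "E u" e] e by simp
    also have "\<dots> \<le> norm u" by (rule norm_E_le) (simp add: u_def)
    also have "\<dots> \<le> 1" by fact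
    also have "E u = id_blinfun - s *\<^sub>R E x" by (simp add: u_def E_diff E_scaleR)
    finally have "s * Re (cinner e (E x e)) \<ge> 0"
      using e by (simp add: blinfun.diff_left blinfun.scaleR_left cinner_simps cinner_self)
    then have "Re (cinner e (E x e)) \<ge> 0"
      using X by (simp add: s_def zero_le_divide_iff)
    then show ?thesis
      by (subst cinner_sgn) (simp_all add: e_def)
  qed
  then show ?thesis
    using selfadjoint_Im[OF E_selfadjoint[OF sa]] by (simp add: positive_op_def)
qed

section \<open>Tomiyama's theorem\<close>

text \<open>The proof that \<open>E\<close> is a bimodule map studies the defect \<open>a \<mapsto> E (a x) - a (E x)\<close> for fixed \<open>x\<close>.
  Contractivity of \<open>E\<close> near unitaries shows that the left and the right defect are opposite
  (\<open>E_jordan\<close>). Associativity then makes the defect a symmetrised derivation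
  (\<open>defect_compose_twice\<close>) that vanishes on commutators, which forces \<open>a\<close> to commute with its
  own defect (\<open>defect_commutes\<close>). So the defect of \<open>b\<^sup>n\<close> is \<open>n b\<^sup>n\<^sup>-\<^sup>1\<close> times that of \<open>b\<close>, and this
  grows too fast for a bounded map unless the defect is zero
  (\<open>defect_zero_selfadjoint\<close>).\<close>

definition defect :: "('h \<Rightarrow>\<^sub>L 'h) \<Rightarrow> ('h \<Rightarrow>\<^sub>L 'h) \<Rightarrow> ('h \<Rightarrow>\<^sub>L 'h)" where
  "defect a x = E (a \<odot> x) - a \<odot> E x"

lemma defect_N [simp]: "a \<in> N \<Longrightarrow> x \<in> BH \<Longrightarrow> defect a x \<in> N"
  by (simp add: defect_def)

text \<open>Let \<open>v\<close> be the second-order Taylor polynomial of \<open>exp (\<i> t a)\<close>. Then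
  \<open>v\<^sup>*v = 1 + t\<^sup>4 a\<^sup>4 / 4\<close>, so \<open>v\<close> is unitary up to fourth order, while
  \<open>Im \<langle>v h, E (v x) h\<rangle>\<close> is \<open>t \<delta>\<close> up to second order, with \<open>\<delta>\<close> the quantity to be shown zero. The
  perturbation bound with \<open>\<epsilon> = l t\<close>, divided by \<open>t\<^sup>2\<close>, tends to \<open>l \<delta> \<le> l\<^sup>2 \<parallel>x\<parallel>\<^sup>2 / 2\<close> as
  \<open>t \<longlonglongrightarrow> 0\<close>, and \<open>l\<close> is arbitrary.\<close>

lemma Re_defect_zero:
  assumes a: "a \<in> N" "selfadjoint a" and x: "selfadjoint x" and h: "norm h = 1"
  shows "Re (cinner h (defect a x h)) = 0"
proof -
  note [simp] = selfadjoint_BH[OF x] N_BH[OF a(1)]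
  note sa = selfadjoint_cinner[OF a(2)]
  define v where "v t = id_blinfun + scale_op (\<i> * of_real t) a - scale_op (of_real (t\<^sup>2 / 2)) (a \<odot> a)" for t
  have v_apply: "v t k = k + (\<i> * of_real t) *\<^sub>C a k - of_real (t\<^sup>2 / 2) *\<^sub>C a (a k)" for t k
    by (simp add: v_def blinfun.add_left blinfun.diff_left)
  have norm_v_apply: "(norm (v t k))\<^sup>2 = (norm k)\<^sup>2 + (t^4 / 4) * (norm (a (a k)))\<^sup>2" for t k
  proof -
    have "cinner (v t k) (v t k) = cinner k k + of_real (t^4 / 4) * cinner (a (a k)) (a (a k))"
      by (simp add: v_apply cinner_simps sa power2_eq_square power4_eq_xxxx field_simps)
    then have "complex_of_real ((norm (v t k))\<^sup>2) = of_real ((norm k)\<^sup>2 + (t^4 / 4) * (norm (a (a k)))\<^sup>2)"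
      by (simp add: cinner_self)
    then show ?thesis by (simp only: of_real_eq_iff)
  qed
  define q where "q t = 1 + (t^4 / 4) * (norm a)^4" for t
  have q: "q t \<ge> 0" for t by (simp add: q_def)
  have norm_v: "(norm (v t))\<^sup>2 \<le> q t" for t
  proof -
    have "norm (v t) \<le> sqrt (q t)"
    proof (rule norm_blinfun_bound)
      fix k
      have "norm (a (a k)) \<le> norm a * (norm a * norm k)"
        by (meson norm_blinfun norm_ge_zero mult_left_mono order_trans)
      then have "(norm (a (a k)))\<^sup>2 \<le> (norm a * (norm a * norm k))\<^sup>2"
        by (rule power_mono) simp
      then have "(t^4 / 4) * (norm (a (a k)))\<^sup>2 \<le> (t^4 / 4) * (norm a * (norm a * norm k))\<^sup>2"
        by (rule mult_left_mono) simp
      moreover have "q t * (norm k)\<^sup>2 = (norm k)\<^sup>2 + (t^4 / 4) * (norm a * (norm a * norm k))\<^sup>2"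
        by (simp add: q_def algebra_simps power2_eq_square power4_eq_xxxx)
      ultimately have "(norm (v t k))\<^sup>2 \<le> q t * (norm k)\<^sup>2"
        by (simp only: norm_v_apply)
      also have "\<dots> = (sqrt (q t) * norm k)\<^sup>2" using q[of t] by (simp add: power_mult_distrib)
      finally show "norm (v t k) \<le> sqrt (q t) * norm k"
        by (rule power2_le_imp_le) (use q[of t] in simp)
    qed (use q in simp)
    then have "(norm (v t))\<^sup>2 \<le> (sqrt (q t))\<^sup>2" by (rule power_mono) simp
    then show ?thesis using q[of t] by simp
  qed
  define y0 y1 y2 where "y0 = E x h" and "y1 = E (a \<odot> x) h" and "y2 = E (a \<odot> (a \<odot> x)) h"
  define \<delta> where "\<delta> = Re (cinner h (defect a x h))"
  define c2 c3 c4 where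
    "c2 = Im (cinner (a h) y1 - cinner h y2 / 2 - cinner (a (a h)) y0 / 2)"
    and "c3 = Im (\<i> * cinner (a h) y2 / 2 - \<i> * cinner (a (a h)) y1 / 2)"
    and "c4 = Im (cinner (a (a h)) y2 / 4)"
  have Ev: "E (v t \<odot> x) h = y0 + (\<i> * of_real t) *\<^sub>C y1 - of_real (t\<^sup>2 / 2) *\<^sub>C y2" for t
    unfolding v_def y0_def y1_def y2_def
    by (simp add: compose_distribs compose_scale_op compose_assoc E_add E_diff E_scale
        blinfun.add_left blinfun.diff_left)
  have im: "Im (cinner h y0) = 0"
    unfolding y0_def by (rule selfadjoint_Im[OF E_selfadjoint[OF x]])
  have re: "Re (cinner h y1) = \<delta> + Re (cinner (a h) y0)"
    by (simp add: \<delta>_def defect_def y0_def y1_def blinfun.diff_left cinner_simps sa)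
  \<comment> \<open>no constant term, because \<open>\<langle>h, E x h\<rangle>\<close> is real\<close>
  have expand: "Im (cinner (v t h) (E (v t \<odot> x) h)) = t * (\<delta> + t * c2 + t\<^sup>2 * c3 + t^3 * c4)" for t
    unfolding Ev v_apply c2_def c3_def c4_def
    by (simp add: cinner_simps im re power2_eq_square power3_eq_cube field_simps)
  have "\<delta> = 0"
  proof (rule quadratic_bound_zero)
    fix l :: real
    have *: "l * (\<delta> + t * c2 + t\<^sup>2 * c3 + t^3 * c4) \<le>
        t\<^sup>2 / 4 * (norm a)^4 + q t * (l\<^sup>2 * (norm x)\<^sup>2 / 2)" if t: "t \<noteq> 0" for t
    proof -
      have "1 \<le> (norm (v t h))\<^sup>2" by (simp add: norm_v_apply h)
      moreover have "v t \<in> N" using a by (simp add: v_def)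
      ultimately have "l * t * (t * (\<delta> + t * c2 + t\<^sup>2 * c3 + t^3 * c4)) \<le>
         q t * (1 + (l * t)\<^sup>2 * (norm x)\<^sup>2 / 2) - 1"
        using E_perturbation_bound[OF _ norm_v x h, of t "l * t"] by (simp add: expand)
      also have "\<dots> = t\<^sup>2 * (t\<^sup>2 / 4 * (norm a)^4 + q t * (l\<^sup>2 * (norm x)\<^sup>2 / 2))"
        by (simp add: q_def field_simps power2_eq_square power4_eq_xxxx)
      finally have "t\<^sup>2 * (l * (\<delta> + t * c2 + t\<^sup>2 * c3 + t^3 * c4)) \<le>
         t\<^sup>2 * (t\<^sup>2 / 4 * (norm a)^4 + q t * (l\<^sup>2 * (norm x)\<^sup>2 / 2))"
        by (simp add: power2_eq_square mult_ac)
      then show ?thesis by (rule mult_left_le_imp_le) (use t in simp)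
    qed
    have L: "((\<lambda>t. l * (\<delta> + t * c2 + t\<^sup>2 * c3 + t^3 * c4)) \<longlongrightarrow> l * (\<delta> + 0 * c2 + 0\<^sup>2 * c3 + 0^3 * c4)) (at 0)"
      by (intro tendsto_intros)
    have R: "((\<lambda>t. t\<^sup>2 / 4 * (norm a)^4 + q t * (l\<^sup>2 * (norm x)\<^sup>2 / 2)) \<longlongrightarrow>
        0\<^sup>2 / 4 * (norm a)^4 + (1 + (0^4 / 4) * (norm a)^4) * (l\<^sup>2 * (norm x)\<^sup>2 / 2)) (at 0)"
      unfolding q_def by (intro tendsto_intros) auto
    have "l * (\<delta> + 0 * c2 + 0\<^sup>2 * c3 + 0^3 * c4) \<le>
        0\<^sup>2 / 4 * (norm a)^4 + (1 + (0^4 / 4) * (norm a)^4) * (l\<^sup>2 * (norm x)\<^sup>2 / 2)"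
      by (rule tendsto_le[OF at_neq_bot R L])
         (rule eventually_mono[OF eventually_neq_at_within[of 0]], rule *)
    then show "l * \<delta> \<le> l\<^sup>2 * ((norm x)\<^sup>2 / 2)" by simp
  qed
  then show ?thesis by (simp add: \<delta>_def)
qed

text \<open>The defect has an imaginary quadratic form, so it is skew-adjoint; its adjoint is the
  corresponding defect for multiplication from the right.\<close>

lemma E_jordan_selfadjoint:
  assumes a: "a \<in> N" "selfadjoint a" and x: "selfadjoint x"
  shows "E (a \<odot> x) + E (x \<odot> a) = a \<odot> E x + E x \<odot> a"
proof -
  note [simp] = selfadjoint_BH[OF x] N_BH[OF a(1)]
  have re: "Re (cinner h (defect a x h)) = 0" for h
  proof (cases "h = 0")
    case False
    then have "norm (sgn h) = 1" by (simp add: norm_sgn)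
    then show ?thesis using Re_defect_zero[OF a x] a by (subst cinner_sgn) simp_all
  qed simp
  have "adj (defect a x) = - defect a x"
  proof (rule op_eqI_quadratic)
    fix h
    show "cinner h (adj (defect a x) h) = cinner h ((- defect a x) h)"
      using re[of h] a by (simp add: cinner_adj_right cinner_commute[of "defect a x h" h]
        blinfun.minus_left cinner_minus_right complex_eq_iff)
  qed (use a in auto)
  moreover have "adj (defect a x) = E (x \<odot> a) - E x \<odot> a"
  proof -
    have "adj a = a" "adj x = x" "adj (E x) = E x"
      using a x E_selfadjoint[OF x] by (auto simp: selfadjoint_def)
    then show ?thesis
      by (simp add: defect_def adj_diff adj_compose E_adj[symmetric])
  qed
  ultimately have "- defect a x = E (x \<odot> a) - E x \<odot> a" by simp
  then show ?thesis by (simp add: defect_def algebra_simps)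
qed

lemma cartesian_decomposition_N:
  assumes "x \<in> N"
  obtains a b where "a \<in> N" "b \<in> N" "selfadjoint a" "selfadjoint b" "x = a + scale_op \<i> b"
proof -
  obtain a b where ab: "selfadjoint a" "selfadjoint b" "x = a + scale_op \<i> b"
    "a = (1/2) *\<^sub>R (x + adj x)" "b = scale_op (- (\<i>/2)) (x - adj x)"
    using cartesian_decomposition[OF N_BH[OF assms]] .
  have "a \<in> N" "b \<in> N"
    unfolding ab(4,5) using assms by simp_all
  then show thesis using ab(1,2,3) by (rule that)
qed

lemma E_jordan:
  assumes "a \<in> N" "x \<in> BH"
  shows "E (a \<odot> x) + E (x \<odot> a) = a \<odot> E x + E x \<odot> a"
proof -
  obtain a1 a2 where a: "a1 \<in> N" "a2 \<in> N" "selfadjoint a1" "selfadjoint a2" "a = a1 + scale_op \<i> a2"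
    using cartesian_decomposition_N[OF assms(1)] by metis
  obtain x1 x2 where x: "selfadjoint x1" "selfadjoint x2" "x = x1 + scale_op \<i> x2"
    using cartesian_decomposition[OF assms(2)] by metis
  note [simp] = selfadjoint_BH[OF x(1)] selfadjoint_BH[OF x(2)] a(1,2)
  have *: "E (b \<odot> x) + E (x \<odot> b) = b \<odot> E x + E x \<odot> b" if b: "b \<in> N" "selfadjoint b" for b
  proof -
    note j = E_jordan_selfadjoint[OF b x(1)] arg_cong[OF E_jordan_selfadjoint[OF b x(2)], of "scale_op \<i>"]
    show ?thesis
      using j b(1)
      by (simp add: x(3) compose_distribs compose_scale_op E_add E_scale scale_op_add algebra_simps)
  qed
  have "E (a1 \<odot> x) + E (x \<odot> a1) = a1 \<odot> E x + E x \<odot> a1"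
    "scale_op \<i> (E (a2 \<odot> x)) + scale_op \<i> (E (x \<odot> a2)) = scale_op \<i> (a2 \<odot> E x) + scale_op \<i> (E x \<odot> a2)"
    using *[OF a(1,3)] arg_cong[OF *[OF a(2,4)], of "scale_op \<i>"] by (simp_all add: scale_op_add)
  then show ?thesis
    using assms(2) by (simp add: a(5) compose_distribs compose_scale_op E_add E_scale algebra_simps)
qed

lemma E_right_eq: "a \<in> N \<Longrightarrow> x \<in> BH \<Longrightarrow> E (x \<odot> a) = E x \<odot> a - defect a x"
  using E_jordan[of a x] by (simp add: defect_def algebra_simps)

lemma E_left_eq: "E (a \<odot> x) = a \<odot> E x + defect a x"
  by (simp add: defect_def)

text \<open>Both ways of bracketing \<open>a x b\<close> express \<open>E (a x b)\<close> through \<open>a (E x) b\<close> and defects; the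
  difference of the two expressions is this identity. Its right-hand side is symmetric in \<open>a\<close>
  and \<open>b\<close>, so the defect vanishes on commutators.\<close>

lemma defect_compose_twice:
  assumes [simp]: "a \<in> N" "b \<in> N" "x \<in> BH"
  shows "defect (b \<odot> a) x + defect (b \<odot> a) x =
    a \<odot> defect b x + defect b x \<odot> a + defect a x \<odot> b + b \<odot> defect a x"
proof -
  have 1: "defect a (x \<odot> b) = defect (b \<odot> a) x - defect b x \<odot> a"
  proof -
    have "defect a (x \<odot> b) = E (x \<odot> b) \<odot> a - E ((x \<odot> b) \<odot> a)"
      by (simp add: E_right_eq[of a "x \<odot> b"])
    also have "\<dots> = (E x \<odot> b - defect b x) \<odot> a - (E x \<odot> (b \<odot> a) - defect (b \<odot> a) x)"
      by (simp add: E_right_eq[of b x] E_right_eq[of "b \<odot> a" x] compose_assoc)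
    finally show ?thesis by (simp add: compose_distribs compose_assoc)
  qed
  have 2: "defect b (a \<odot> x) = defect (b \<odot> a) x - b \<odot> defect a x"
    by (simp add: defect_def compose_assoc compose_distribs)
  have "E (a \<odot> (x \<odot> b)) = a \<odot> E x \<odot> b - a \<odot> defect b x + (defect (b \<odot> a) x - defect b x \<odot> a)"
    by (simp add: E_left_eq[of a "x \<odot> b"] 1 E_right_eq compose_distribs compose_assoc)
  moreover have "E ((a \<odot> x) \<odot> b) =
      a \<odot> E x \<odot> b + defect a x \<odot> b - (defect (b \<odot> a) x - b \<odot> defect a x)"
    by (simp add: E_right_eq[of b "a \<odot> x"] 2 E_left_eq[of a x] compose_distribs)
  ultimately have "a \<odot> E x \<odot> b - a \<odot> defect b x + (defect (b \<odot> a) x - defect b x \<odot> a) =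
      a \<odot> E x \<odot> b + defect a x \<odot> b - (defect (b \<odot> a) x - b \<odot> defect a x)"
    by (simp only: compose_assoc)
  then show ?thesis by (simp add: algebra_simps)
qed

lemma defect_commute:
  assumes "a \<in> N" "b \<in> N" "x \<in> BH"
  shows "defect (a \<odot> b) x = defect (b \<odot> a) x"
  by (rule double_cancel) (simp add: defect_compose_twice assms algebra_simps)

lemma defect_diff: "a \<in> N \<Longrightarrow> b \<in> N \<Longrightarrow> x \<in> BH \<Longrightarrow> defect (a - b) x = defect a x - defect b x"
  by (simp add: defect_def compose_distribs E_diff)

text \<open>With \<open>k = [a, c]\<close>, both \<open>k\<close> and \<open>a k = [a, a c]\<close> are commutators, so their defects vanish;
  what remains of the product formula for \<open>a k\<close> is the claim.\<close>

lemma defect_anticommutes_commutator: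
  assumes [simp]: "a \<in> N" "c \<in> N" "x \<in> BH"
  shows "(a \<odot> c - c \<odot> a) \<odot> defect a x + defect a x \<odot> (a \<odot> c - c \<odot> a) = 0"
proof -
  let ?k = "a \<odot> c - c \<odot> a"
  have k: "defect ?k x = 0"
    using defect_commute[of a c x] by (subst defect_diff) simp_all
  have "a \<odot> ?k = a \<odot> (a \<odot> c) - (a \<odot> c) \<odot> a"
    by (simp add: compose_distribs compose_assoc)
  then have "defect (a \<odot> ?k) x = 0"
    using defect_commute[of a "a \<odot> c" x] by (simp only:) (subst defect_diff, simp_all)
  then show ?thesis
    using defect_compose_twice[of ?k a x] k by (simp add: compose_distribs)
qed

text \<open>Let \<open>d\<close> be the defect and \<open>k = [a, d]\<close>. By the previous lemma for \<open>c = d\<close> and \<open>c = a d\<close>, the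
  operator \<open>d\<close> anticommutes with \<open>k\<close> and with \<open>a k\<close>; together this gives \<open>k\<^sup>2 = 0\<close>. As \<open>d\<close> is
  skew-adjoint, \<open>k\<close> is self-adjoint, and therefore \<open>k = 0\<close>.\<close>

lemma defect_commutes:
  assumes a: "a \<in> N" "selfadjoint a" and x: "selfadjoint x"
  shows "a \<odot> defect a x = defect a x \<odot> a"
proof -
  note [simp] = selfadjoint_BH[OF x] a(1)
  define d where "d = defect a x"
  have d [simp]: "d \<in> N" by (simp add: d_def)
  define k where "k = a \<odot> d - d \<odot> a"
  have 1: "d \<odot> k = - (k \<odot> d)"
    using defect_anticommutes_commutator[of a d x]
    by (simp add: d_def[symmetric] k_def[symmetric] eq_neg_iff_add_eq_0 add.commute)
  have "a \<odot> (a \<odot> d) - (a \<odot> d) \<odot> a = a \<odot> k"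
    by (simp add: k_def compose_distribs compose_assoc)
  then have 2: "(a \<odot> k) \<odot> d + d \<odot> (a \<odot> k) = 0"
    using defect_anticommutes_commutator[of a "a \<odot> d" x] by (simp add: d_def[symmetric])
  have "k \<odot> k = a \<odot> (d \<odot> k) - d \<odot> (a \<odot> k)"
    by (subst k_def) (simp add: compose_distribs compose_assoc)
  also have "\<dots> = - ((a \<odot> k) \<odot> d + d \<odot> (a \<odot> k))"
    by (simp add: 1 compose_distribs compose_assoc)
  finally have kk: "k \<odot> k = 0" by (simp add: 2)
  have adj_d: "adj d = - d"
  proof -
    have "adj a = a" "adj x = x" "adj (E x) = E x"
      using a x E_selfadjoint[OF x] by (auto simp: selfadjoint_def)
    then have "adj d = E (x \<odot> a) - E x \<odot> a"
      by (simp add: d_def defect_def adj_diff adj_compose E_adj[symmetric])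
    then show ?thesis by (simp add: E_right_eq d_def)
  qed
  have "adj a = a" using a by (simp add: selfadjoint_def)
  then have "adj k = k"
    by (simp add: k_def adj_diff adj_compose adj_d compose_distribs)
  then have sak: "selfadjoint k" by (simp add: selfadjoint_def k_def)
  have "k h = 0" for h
  proof -
    have "cinner (k h) (k h) = cinner h ((k \<odot> k) h)" by (simp add: selfadjoint_cinner[OF sak])
    then show ?thesis by (simp add: kk cinner_self)
  qed
  then have "k = 0" by (simp add: blinfun_eqI)
  then show ?thesis by (simp add: k_def d_def)
qed

primrec opow :: "('h \<Rightarrow>\<^sub>L 'h) \<Rightarrow> nat \<Rightarrow> ('h \<Rightarrow>\<^sub>L 'h)" where
  "opow b 0 = id_blinfun"
| "opow b (Suc n) = b \<odot> opow b n"

lemma opow_N [simp]: "b \<in> N \<Longrightarrow> opow b n \<in> N"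
  by (induction n) auto

lemma opow_commute: "e \<odot> b = b \<odot> e \<Longrightarrow> e \<odot> opow b n = opow b n \<odot> e"
  by (induction n) (simp_all, metis compose_assoc)

lemma norm_opow_le: "norm (opow b n) \<le> norm b ^ n"
proof (induction n)
  case 0
  show ?case using norm_blinfun_id_le by simp
next
  case (Suc n)
  have "norm (opow b (Suc n)) \<le> norm b * norm (opow b n)" by (simp add: norm_blinfun_compose)
  also have "\<dots> \<le> norm b * norm b ^ n" using Suc by (rule mult_left_mono) simp
  finally show ?case by simp
qed

text \<open>The power rule for a derivation, in the shape that avoids the exponent \<open>n - 1\<close>.\<close>

lemma defect_opow:
  assumes [simp]: "b \<in> N" "x \<in> BH" and comm: "b \<odot> defect b x = defect b x \<odot> b"
  shows "defect (opow b (Suc n)) x = real (Suc n) *\<^sub>R (opow b n \<odot> defect b x)"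
proof (induction n)
  case (Suc n)
  define e where "e = defect b x"
  have c: "e \<odot> opow b n = opow b n \<odot> e" for n
    using comm by (intro opow_commute) (simp add: e_def)
  have cb: "b \<odot> opow b n = opow b n \<odot> b" for n by (rule opow_commute) simp
  have IH: "defect (opow b (Suc n)) x = real (Suc n) *\<^sub>R (opow b n \<odot> e)"
    using Suc by (simp add: e_def)
  have r: "(opow b n \<odot> e) \<odot> b = opow b (Suc n) \<odot> e"
  proof -
    have "(opow b n \<odot> e) \<odot> b = (opow b n \<odot> b) \<odot> e"
      using comm by (simp add: compose_assoc e_def)
    then show ?thesis by (simp add: cb)
  qed
  have "defect (opow b (Suc (Suc n))) x + defect (opow b (Suc (Suc n))) x =
     opow b (Suc n) \<odot> e + e \<odot> opow b (Suc n) + defect (opow b (Suc n)) x \<odot> b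
       + b \<odot> defect (opow b (Suc n)) x"
    using defect_compose_twice[of "opow b (Suc n)" b x] by (simp add: e_def)
  also have "\<dots> = real (Suc (Suc n)) *\<^sub>R (opow b (Suc n) \<odot> e) + real (Suc (Suc n)) *\<^sub>R (opow b (Suc n) \<odot> e)"
    unfolding IH c
    by (simp add: compose_distribs r compose_assoc[symmetric] scaleR_add_left scaleR_2)
  finally show ?case unfolding e_def by (rule double_cancel)
qed simp

lemma norm_defect_le: "a \<in> N \<Longrightarrow> x \<in> BH \<Longrightarrow> norm (defect a x) \<le> 2 * norm x * norm a"
proof -
  assume [simp]: "a \<in> N" "x \<in> BH"
  have "norm (defect a x) \<le> norm (E (a \<odot> x)) + norm (a \<odot> E x)"
    unfolding defect_def by (rule norm_triangle_ineq4)
  also have "\<dots> \<le> norm (a \<odot> x) + norm a * norm (E x)"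
    by (intro add_mono norm_E_le norm_blinfun_compose) simp
  also have "\<dots> \<le> norm a * norm x + norm a * norm x"
    by (intro add_mono norm_blinfun_compose mult_left_mono norm_E_le) simp_all
  finally show ?thesis by (simp add: mult_ac)
qed

text \<open>Let \<open>b = 1 + (\<i> / m) a\<close> and consider its power \<open>b\<^bsup>m\<^sup>2\<^esup>\<close>. The norm of this power is bounded by
  \<open>exp (\<parallel>a\<parallel>\<^sup>2 / 2)\<close> for every \<open>m\<close>. On the other hand its defect is \<open>m\<^sup>2\<close> times a power of \<open>b\<close>
  times \<open>(\<i> / m) d\<close>, and \<open>b\<close> is bounded below by \<open>1\<close>, so the defect has size at least \<open>m\<close> times
  that of \<open>d\<close>.\<close>

lemma defect_zero_selfadjoint:
  assumes a: "a \<in> N" "selfadjoint a" and x: "selfadjoint x"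
  shows "defect a x = 0"
proof (rule blinfun_eqI)
  note [simp] = selfadjoint_BH[OF x] a(1)
  fix k :: 'h
  define d where "d = defect a x"
  define K where "K = (2 * norm x)\<^sup>2 * exp ((norm a)\<^sup>2) * (norm k)\<^sup>2"
  have main: "(real m)\<^sup>2 * (norm (d k))\<^sup>2 \<le> K" if m: "m > 0" for m :: nat
  proof -
    define \<epsilon> where "\<epsilon> = 1 / real m"
    define b where "b = id_blinfun + scale_op (\<i> * of_real \<epsilon>) a"
    have b [simp]: "b \<in> N" by (simp add: b_def)
    have norm_b: "(norm (b z))\<^sup>2 = (norm z)\<^sup>2 + \<epsilon>\<^sup>2 * (norm (a z))\<^sup>2" for z
      using norm_add_i_selfadjoint[OF a(2), of z \<epsilon>] by (simp add: b_def blinfun.add_left)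
    have expand: "norm z \<le> norm (opow b n z)" for n z
    proof (induction n)
      case (Suc n)
      have "(norm (opow b n z))\<^sup>2 \<le> (norm (b (opow b n z)))\<^sup>2" by (simp add: norm_b)
      then have "norm (opow b n z) \<le> norm (b (opow b n z))" by (rule power2_le_imp_le) simp
      then show ?case using Suc by simp
    qed simp
    have "norm b \<le> sqrt (1 + \<epsilon>\<^sup>2 * (norm a)\<^sup>2)"
    proof (rule norm_blinfun_bound)
      fix z
      have "(norm (b z))\<^sup>2 \<le> (norm z)\<^sup>2 + \<epsilon>\<^sup>2 * (norm a * norm z)\<^sup>2"
        unfolding norm_b by (intro add_left_mono mult_left_mono power_mono norm_blinfun) auto
      also have "\<dots> = (sqrt (1 + \<epsilon>\<^sup>2 * (norm a)\<^sup>2) * norm z)\<^sup>2"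
        by (simp add: power_mult_distrib algebra_simps)
      finally show "norm (b z) \<le> sqrt (1 + \<epsilon>\<^sup>2 * (norm a)\<^sup>2) * norm z"
        by (rule power2_le_imp_le) simp
    qed simp
    then have "(norm b)\<^sup>2 \<le> (sqrt (1 + \<epsilon>\<^sup>2 * (norm a)\<^sup>2))\<^sup>2" by (rule power_mono) simp
    then have "(norm b)\<^sup>2 \<le> 1 + \<epsilon>\<^sup>2 * (norm a)\<^sup>2" by simp
    also have "\<dots> \<le> exp (\<epsilon>\<^sup>2 * (norm a)\<^sup>2)" by (rule exp_ge_add_one_self)
    finally have b2: "(norm b)\<^sup>2 \<le> exp (\<epsilon>\<^sup>2 * (norm a)\<^sup>2)" .
    \<comment> \<open>the exponent \<open>m\<^sup>2\<close> balances \<open>\<epsilon>\<^sup>2 = 1 / m\<^sup>2\<close> in the bound for \<open>\<parallel>b\<parallel>\<^sup>2\<close>\<close>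
    obtain n where n: "Suc n = m\<^sup>2" using m by (metis gr0_conv_Suc zero_less_power)
    have "(norm b ^ Suc n)\<^sup>2 = ((norm b)\<^sup>2) ^ Suc n" by (simp only: power_mult[symmetric] mult.commute)
    also have "\<dots> \<le> exp (\<epsilon>\<^sup>2 * (norm a)\<^sup>2) ^ Suc n" by (rule power_mono[OF b2]) simp
    also have "\<dots> = exp (real (Suc n) * (\<epsilon>\<^sup>2 * (norm a)\<^sup>2))" by (rule exp_of_nat_mult[symmetric])
    also have "real (Suc n) * (\<epsilon>\<^sup>2 * (norm a)\<^sup>2) = (norm a)\<^sup>2"
      unfolding n using m by (simp add: \<epsilon>_def power_divide)
    finally have bn: "(norm b ^ Suc n)\<^sup>2 \<le> exp ((norm a)\<^sup>2)" .
    have db: "defect b x = scale_op (\<i> * of_real \<epsilon>) d"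
      by (simp add: b_def d_def defect_def compose_distribs compose_scale_op E_add E_scale scale_op_diff)
    have "a \<odot> d = d \<odot> a" unfolding d_def by (rule defect_commutes[OF a x])
    moreover have "d \<in> BH" by (simp add: d_def)
    ultimately have "b \<odot> defect b x = defect b x \<odot> b"
      unfolding db by (simp add: b_def compose_distribs compose_scale_op)
    then have dn: "defect (opow b (Suc n)) x = real (Suc n) *\<^sub>R (opow b n \<odot> defect b x)"
      by (intro defect_opow) auto
    have "real m * norm (d k) = real (Suc n) * norm (defect b x k)"
      using m unfolding n by (simp add: db norm_scaleC norm_mult norm_divide \<epsilon>_def power2_eq_square)
    also have "\<dots> \<le> real (Suc n) * norm (opow b n (defect b x k))"
      by (intro mult_left_mono expand) simp
    also have "\<dots> = norm (defect (opow b (Suc n)) x k)"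
      unfolding dn by (simp add: blinfun.scaleR_left)
    also have "\<dots> \<le> norm (defect (opow b (Suc n)) x) * norm k" by (rule norm_blinfun)
    also have "\<dots> \<le> (2 * norm x * norm (opow b (Suc n))) * norm k"
      by (intro mult_right_mono norm_defect_le) auto
    also have "\<dots> \<le> (2 * norm x * norm b ^ Suc n) * norm k"
      by (intro mult_right_mono mult_left_mono norm_opow_le) auto
    finally have "(real m * norm (d k))\<^sup>2 \<le> ((2 * norm x * norm b ^ Suc n) * norm k)\<^sup>2"
      by (rule power_mono) simp
    also have "\<dots> = (2 * norm x)\<^sup>2 * (norm b ^ Suc n)\<^sup>2 * (norm k)\<^sup>2"
      by (simp only: power_mult_distrib)
    also have "\<dots> \<le> K"
      unfolding K_def by (intro mult_right_mono mult_left_mono bn) auto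
    finally show ?thesis by (simp only: power_mult_distrib)
  qed
  have "norm (d k) = 0"
  proof (rule ccontr)
    assume "norm (d k) \<noteq> 0"
    then have pos: "(norm (d k))\<^sup>2 > 0" by simp
    obtain m :: nat where m: "K / (norm (d k))\<^sup>2 < real m" using reals_Archimedean2 by blast
    then have m': "K / (norm (d k))\<^sup>2 < real (Suc m)" by simp
    have "real (Suc m) \<le> (real (Suc m))\<^sup>2" by (rule self_le_power) auto
    then have "K / (norm (d k))\<^sup>2 < (real (Suc m))\<^sup>2" using m' by linarith
    then have "K < (real (Suc m))\<^sup>2 * (norm (d k))\<^sup>2" using pos by (simp add: field_simps)
    then show False using main[of "Suc m"] by simp
  qed
  then show "defect a x k = (0 :: 'h \<Rightarrow>\<^sub>L 'h) k" by (simp add: d_def)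
qed

text \<open>The defect is bilinear over the complex numbers and \<open>N\<close> is spanned by its self-adjoint
  elements.\<close>

theorem tomiyama_left:
  assumes "a \<in> N" "x \<in> BH"
  shows "E (a \<odot> x) = a \<odot> E x"
proof -
  obtain a1 a2 where a: "a1 \<in> N" "a2 \<in> N" "selfadjoint a1" "selfadjoint a2" "a = a1 + scale_op \<i> a2"
    using cartesian_decomposition_N[OF assms(1)] by metis
  obtain x1 x2 where x: "selfadjoint x1" "selfadjoint x2" "x = x1 + scale_op \<i> x2"
    using cartesian_decomposition[OF assms(2)] by metis
  note [simp] = selfadjoint_BH[OF x(1)] selfadjoint_BH[OF x(2)] a(1,2)
  have "E (a' \<odot> x') = a' \<odot> E x'" if "a' \<in> N" "selfadjoint a'" "selfadjoint x'" for a' x'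
    using defect_zero_selfadjoint[OF that] by (simp add: defect_def)
  then show ?thesis
    using a(1-4) x(1,2)
    by (simp add: a(5) x(3) compose_distribs compose_scale_op E_add E_scale)
qed

theorem tomiyama_right:
  assumes "a \<in> N" "x \<in> BH"
  shows "E (x \<odot> a) = E x \<odot> a"
  using E_jordan[OF assms] tomiyama_left[OF assms] by simp

end

section \<open>Finite orthonormal sets\<close>

definition orthonormal :: "'a::complex_hilbert set \<Rightarrow> bool" where
  "orthonormal F \<longleftrightarrow> finite F \<and> (\<forall>e\<in>F. \<forall>f\<in>F. cinner e f = (if e = f then 1 else 0))"

text \<open>Adjoin the normalised component of \<open>a\<close> orthogonal to the vectors found so far, unless that
  component is zero.\<close>

lemma gram_schmidt:
  assumes "finite A"
  shows "\<exists>F. orthonormal F \<and> (\<forall>a\<in>A. a = (\<Sum>e\<in>F. cinner e a *\<^sub>C e))"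
  using assms
proof (induction A rule: finite_induct)
  case empty
  show ?case by (rule exI[of _ "{}"]) (simp add: orthonormal_def)
next
  case (insert a A)
  then obtain F where F: "orthonormal F" and exp: "\<And>b. b \<in> A \<Longrightarrow> b = (\<Sum>e\<in>F. cinner e b *\<^sub>C e)"
    by blast
  have fin: "finite F" and ons: "\<And>e f. e \<in> F \<Longrightarrow> f \<in> F \<Longrightarrow> cinner e f = (if e = f then 1 else 0)"
    using F by (auto simp: orthonormal_def)
  define p where "p = (\<Sum>e\<in>F. cinner e a *\<^sub>C e)"
  define r where "r = a - p"
  show ?case
  proof (cases "r = 0")
    case True
    then show ?thesis
      using F exp by (intro exI[of _ F]) (auto simp: r_def p_def)
  next
    case False
    \<comment> \<open>the new unit vector\<close>
    define g where "g = (1 / norm r) *\<^sub>R r"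
    have "cinner e r = 0" if "e \<in> F" for e
    proof -
      have "cinner e p = (\<Sum>f\<in>F. if e = f then cinner e a else 0)"
        unfolding p_def cinner_sum_right using ons that
        by (intro sum.cong) (auto simp: cinner_scaleC_right)
      then show ?thesis using fin that by (simp add: r_def cinner_diff_right)
    qed
    then have eg: "cinner e g = 0" if "e \<in> F" for e
      using that by (simp add: g_def cinner_scaleR_right)
    then have ge: "cinner g e = 0" if "e \<in> F" for e
      using that by (metis cinner_commute complex_cnj_zero)
    have gg: "cinner g g = 1"
      using False by (simp add: cinner_self g_def)
    have gF: "g \<notin> F" using eg[of g] gg by auto
    have gb: "cinner g b = 0" if "b \<in> A" for b
    proof -
      have "cinner g b = cinner g (\<Sum>e\<in>F. cinner e b *\<^sub>C e)" using exp[OF that] by (rule arg_cong)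
      also have "\<dots> = 0" using ge by (simp add: cinner_sum_right cinner_scaleC_right)
      finally show ?thesis .
    qed
    have "cinner g p = 0"
      unfolding p_def using ge by (simp add: cinner_sum_right cinner_scaleC_right)
    then have "cinner g a = cinner g r" by (simp add: r_def cinner_diff_right)
    also have "\<dots> = of_real (norm r)"
      using False by (simp add: g_def cinner_scaleR_left cinner_self power2_eq_square)
    finally have "cinner g a *\<^sub>C g = r"
      using False by (simp add: g_def scaleC_of_real)
    then have "a = (\<Sum>e\<in>insert g F. cinner e a *\<^sub>C e)"
      using fin gF by (simp add: p_def[symmetric] r_def)
    moreover have "b = (\<Sum>e\<in>insert g F. cinner e b *\<^sub>C e)" if "b \<in> A" for b
      using fin gF gb[OF that] exp[OF that] by simp
    moreover have "orthonormal (insert g F)"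
      using fin ons eg ge gg gF by (auto simp: orthonormal_def)
    ultimately show ?thesis by blast
  qed
qed

section \<open>Extension of densely defined bounded operators\<close>

text \<open>The operator is given by its graph on a dense domain, as a linear relation. This suits a tensor
  product, where \<open>t a b \<mapsto> t a (x b)\<close> is not visibly single-valued on finite sums: the norm bound
  proves that the closed relation is single-valued, and completeness that its domain is
  everything.\<close>

lemma bounded_extension:
  fixes R :: "('a::banach \<times> 'b::banach) set"
  assumes sub: "subspace R"
    and bound: "\<And>u v. (u, v) \<in> R \<Longrightarrow> norm v \<le> norm u * K"
    and dense: "closure (fst ` R) = UNIV"
  obtains T where "\<And>u v. (u, v) \<in> R \<Longrightarrow> blinfun_apply T u = v"
proof -
  define G where "G z w \<longleftrightarrow> (\<exists>u v. (\<forall>n. (u n, v n) \<in> R) \<and> u \<longlonglongrightarrow> z \<and> v \<longlonglongrightarrow> w)" for z w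
  have G_bound: "norm w \<le> norm z * K" if "G z w" for z w
  proof -
    obtain u v where uv: "\<And>n. (u n, v n) \<in> R" "u \<longlonglongrightarrow> z" "v \<longlonglongrightarrow> w"
      using \<open>G z w\<close> unfolding G_def by blast
    show ?thesis
      by (rule LIMSEQ_le[OF tendsto_norm[OF uv(3)] tendsto_mult_right[OF tendsto_norm[OF uv(2)]]])
         (use bound uv(1) in blast)
  qed
  have G_add: "G (z + z') (w + w')" if "G z w" "G z' w'" for z w z' w'
  proof -
    obtain u v u' v' where uv: "\<And>n. (u n, v n) \<in> R" "u \<longlonglongrightarrow> z" "v \<longlonglongrightarrow> w"
      "\<And>n. (u' n, v' n) \<in> R" "u' \<longlonglongrightarrow> z'" "v' \<longlonglongrightarrow> w'"
      using \<open>G z w\<close> \<open>G z' w'\<close> unfolding G_def by blast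
    have "(u n + u' n, v n + v' n) \<in> R" for n
      using subspace_add[OF sub uv(1)[of n] uv(4)[of n]] by simp
    then show ?thesis
      unfolding G_def using uv
      by (intro exI[of _ "\<lambda>n. u n + u' n"] exI[of _ "\<lambda>n. v n + v' n"]) (auto intro: tendsto_add)
  qed
  have G_scale: "G (r *\<^sub>R z) (r *\<^sub>R w)" if "G z w" for r z w
  proof -
    obtain u v where uv: "\<And>n. (u n, v n) \<in> R" "u \<longlonglongrightarrow> z" "v \<longlonglongrightarrow> w"
      using \<open>G z w\<close> unfolding G_def by blast
    have "(r *\<^sub>R u n, r *\<^sub>R v n) \<in> R" for n
      using subspace_scale[OF sub uv(1)[of n], of r] by simp
    then show ?thesis
      unfolding G_def using uv
      by (intro exI[of _ "\<lambda>n. r *\<^sub>R u n"] exI[of _ "\<lambda>n. r *\<^sub>R v n"]) (auto intro!: tendsto_intros)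
  qed
  \<comment> \<open>the bound at the difference of two pairs over the same \<open>z\<close>\<close>
  have G_unique: "w = w'" if "G z w" "G z w'" for z w w'
    using G_bound[OF G_add[OF that(1) G_scale[OF that(2), of "-1"]]] by simp
  have G_total: "\<exists>w. G z w" for z
  proof -
    have "z \<in> closure (fst ` R)" using dense by simp
    then obtain u where u: "\<And>n. u n \<in> fst ` R" "u \<longlonglongrightarrow> z"
      unfolding closure_sequential by blast
    from u(1) have "\<forall>n. \<exists>y. (u n, y) \<in> R" by force
    then obtain v where v: "\<And>n. (u n, v n) \<in> R" by metis
    have "Cauchy v"
    proof (rule metric_CauchyI)
      fix e :: real assume "0 < e"
      then have "0 < e / (\<bar>K\<bar> + 1)" by simp
      moreover have "Cauchy u" using u(2) by (rule LIMSEQ_imp_Cauchy)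
      ultimately obtain M where M: "\<And>m n. m \<ge> M \<Longrightarrow> n \<ge> M \<Longrightarrow> dist (u m) (u n) < e / (\<bar>K\<bar> + 1)"
        unfolding Cauchy_def by meson
      have "dist (v m) (v n) < e" if "m \<ge> M" "n \<ge> M" for m n
      proof -
        have "(u m - u n, v m - v n) \<in> R"
          using subspace_diff[OF sub v[of m] v[of n]] by simp
        then have "norm (v m - v n) \<le> norm (u m - u n) * K" by (rule bound)
        also have "\<dots> \<le> norm (u m - u n) * (\<bar>K\<bar> + 1)"
          by (rule mult_left_mono) auto
        also have "\<dots> < e / (\<bar>K\<bar> + 1) * (\<bar>K\<bar> + 1)"
          using M[OF that] by (intro mult_strict_right_mono) (auto simp: dist_norm)
        finally show ?thesis by (simp add: dist_norm)
      qed
      then show "\<exists>M. \<forall>m\<ge>M. \<forall>n\<ge>M. dist (v m) (v n) < e" by blast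
    qed
    then obtain w where "v \<longlonglongrightarrow> w" by (auto simp: Cauchy_convergent_iff convergent_def)
    then show ?thesis using u v unfolding G_def by blast
  qed
  then obtain T where T: "\<And>z. G z (T z)" by metis
  have "bounded_linear T"
  proof (rule bounded_linear_intro)
    show "T (x + y) = T x + T y" for x y by (rule G_unique[OF T G_add[OF T T]])
    show "T (r *\<^sub>R x) = r *\<^sub>R T x" for r x by (rule G_unique[OF T G_scale[OF T]])
    show "norm (T x) \<le> norm x * K" for x by (rule G_bound[OF T])
  qed
  then have "blinfun_apply (Blinfun T) = T" by (rule bounded_linear_Blinfun_apply)
  moreover have "T u = v" if "(u, v) \<in> R" for u v
  proof (rule G_unique[OF T])
    show "G u v" unfolding G_def
      by (rule exI[of _ "\<lambda>_. u"], rule exI[of _ "\<lambda>_. v"]) (use that in auto)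
  qed
  ultimately show thesis by (intro that[of "Blinfun T"]) simp
qed

section \<open>Tensor products of Hilbert spaces\<close>

text \<open>The operator \<open>|a\<rangle> \<otimes> 1\<close>, which creates the left tensor factor \<open>a\<close>.\<close>

definition leg :: "('a::complex_hilbert \<Rightarrow> 'b::complex_hilbert \<Rightarrow> 'c::complex_hilbert) \<Rightarrow> 'a \<Rightarrow> 'b \<Rightarrow>\<^sub>L 'c" where
  "leg t a = Blinfun (t a)"

locale hilbert_tensor_product =
  fixes t :: "'a::complex_hilbert \<Rightarrow> 'b::complex_hilbert \<Rightarrow> 'c::complex_hilbert"
  assumes tensor: "hilbert_tensor t"
begin

lemma t_add_left: "t (a + a') b = t a b + t a' b"
  and t_add_right: "t a (b + b') = t a b + t a b'"
  and t_scaleC_left: "t (c *\<^sub>C a) b = c *\<^sub>C t a b"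
  and t_scaleC_right: "t a (c *\<^sub>C b) = c *\<^sub>C t a b"
  and cinner_t: "cinner (t a b) (t a' b') = cinner a a' * cinner b b'"
  and dense: "closure (span {t a b | a b. True}) = UNIV"
  using tensor unfolding hilbert_tensor_def by blast+

lemma norm_t: "norm (t a b) = norm a * norm b"
proof -
  have "complex_of_real ((norm (t a b))\<^sup>2) = of_real ((norm a * norm b)\<^sup>2)"
    using cinner_t[of a b a b] by (simp add: cinner_self power_mult_distrib)
  then have "(norm (t a b))\<^sup>2 = (norm a * norm b)\<^sup>2"
    by (simp only: of_real_eq_iff)
  then show ?thesis by simp
qed

lemma leg_apply [simp]: "leg t a b = t a b"
proof -
  have "bounded_linear (t a)"
    by (rule bounded_linear_intro[of _ "norm a"])
       (auto simp: t_add_right scaleR_eq_scaleC t_scaleC_right norm_t)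
  then show ?thesis unfolding leg_def by (simp add: bounded_linear_Blinfun_apply)
qed

lemma leg_BH [simp]: "leg t a \<in> BH"
  by (simp add: BH_def t_scaleC_right)

lemma norm_leg_le: "norm (leg t a) \<le> norm a"
  by (rule norm_blinfun_bound) (auto simp: norm_t)

lemma leg_add: "leg t (a + a') = leg t a + leg t a'"
  by (rule blinfun_eqI) (simp add: t_add_left blinfun.add_left)

lemma leg_scaleC: "leg t (c *\<^sub>C a) = scale_op c (leg t a)"
  by (rule blinfun_eqI) (simp add: t_scaleC_left)

lemma adj_leg_t: "adj (leg t e) (t a b) = cinner e a *\<^sub>C b"
  by (rule cinner_eqI) (simp add: cinner_adj_right cinner_t cinner_scaleC_right)

lemma t_sum_left: "t (\<Sum>i\<in>I. f i) b = (\<Sum>i\<in>I. t (f i) b)"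
proof (induction I rule: infinite_finite_induct)
  have "t 0 b = 0" using norm_t[of 0 b] by simp
  then show "t (\<Sum>i\<in>{}. f i) b = (\<Sum>i\<in>{}. t (f i) b)"
    "infinite I \<Longrightarrow> t (\<Sum>i\<in>I. f i) b = (\<Sum>i\<in>I. t (f i) b)" for I by simp_all
qed (auto simp: t_add_left)

lemma t_sum_right: "t a (\<Sum>i\<in>I. f i) = (\<Sum>i\<in>I. t a (f i))"
  using blinfun.sum_right[of "leg t a" f I] by simp

lemma tensor_eqI:
  assumes "\<And>a b. blinfun_apply S (t a b) = blinfun_apply T (t a b)"
  shows "S = T"
proof (rule blinfun_eqI)
  fix z
  have "span {t a b | a b. True} \<subseteq> {z. S z = T z}"
    by (rule span_minimal)
       (auto simp: assms subspace_def blinfun.add_right blinfun.scaleR_right blinfun.zero_right)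
  moreover have "closed {z. S z = T z}"
    by (intro closed_Collect_eq continuous_intros)
  ultimately have "closure (span {t a b | a b. True}) \<subseteq> {z. S z = T z}"
    by (rule closure_minimal)
  then show "S z = T z" using dense by auto
qed

text \<open>A finite sum of elementary tensors can be rewritten with orthonormal left factors. The
  image under \<open>1 \<otimes> x\<close> is rewritten with the same coefficients, which gives the norm bound for
  \<open>1 \<otimes> x\<close> by Pythagoras.\<close>

lemma orthonormal_representation_pair:
  assumes "x \<in> BH" "p \<in> span {(t a b, t a (blinfun_apply x b)) | a b. True}"
  shows "\<exists>F c. orthonormal F \<and> p = (\<Sum>e\<in>F. t e (c e), \<Sum>e\<in>F. t e (x (c e)))"
  using assms(2)
proof (induction rule: span_induct_alt)
  case base
  show ?case by (rule exI[of _ "{}"]) (simp add: orthonormal_def zero_prod_def)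
next
  case (step r s q)
  then obtain a b where s: "s = (t a b, t a (x b))" by blast
  obtain F c where F: "orthonormal F" and q: "q = (\<Sum>e\<in>F. t e (c e), \<Sum>e\<in>F. t e (x (c e)))"
    using step by blast
  have "finite (insert a F)" using F by (simp add: orthonormal_def)
  then obtain G where G: "orthonormal G" and exp: "\<And>f. f \<in> insert a F \<Longrightarrow> f = (\<Sum>g\<in>G. cinner g f *\<^sub>C g)"
    using gram_schmidt by metis
  have expand: "t f d = (\<Sum>g\<in>G. t g (cinner g f *\<^sub>C d))" if "f \<in> insert a F" for f d
  proof -
    have "t f d = t (\<Sum>g\<in>G. cinner g f *\<^sub>C g) d" using exp[OF that] by (rule arg_cong)
    then show ?thesis by (simp add: t_sum_left t_scaleC_left t_scaleC_right)
  qed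
  \<comment> \<open>the coefficient of the orthonormal vector \<open>g\<close> after expanding all left factors\<close>
  define D where "D d y g = (\<Sum>f\<in>F. cinner g f *\<^sub>C d f) + of_real r *\<^sub>C cinner g a *\<^sub>C y" for d and y :: 'b and g
  have sum: "(\<Sum>g\<in>G. t g (D d y g)) = r *\<^sub>R t a y + (\<Sum>f\<in>F. t f (d f))" for d y
  proof -
    have "(\<Sum>f\<in>F. t f (d f)) = (\<Sum>f\<in>F. \<Sum>g\<in>G. t g (cinner g f *\<^sub>C d f))"
      by (intro sum.cong refl expand) simp
    also have "\<dots> = (\<Sum>g\<in>G. \<Sum>f\<in>F. t g (cinner g f *\<^sub>C d f))" by (rule sum.swap)
    finally have "(\<Sum>f\<in>F. t f (d f)) = (\<Sum>g\<in>G. t g (\<Sum>f\<in>F. cinner g f *\<^sub>C d f))"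
      by (simp add: t_sum_right)
    moreover have "r *\<^sub>R t a y = (\<Sum>g\<in>G. t g (of_real r *\<^sub>C cinner g a *\<^sub>C y))"
      by (subst expand[of a y]) (simp_all add: scaleR_eq_scaleC t_scaleC_right scaleC_sum_right)
    ultimately show ?thesis
      by (simp add: D_def t_add_right sum.distrib add.commute)
  qed
  have "x (D c b g) = D (\<lambda>f. x (c f)) (x b) g" for g
    by (simp add: D_def blinfun.add_right blinfun.sum_right BH_scaleC[OF assms(1)])
  then have "r *\<^sub>R s + q = (\<Sum>g\<in>G. t g (D c b g), \<Sum>g\<in>G. t g (x (D c b g)))"
    by (simp add: sum s q)
  then show ?case using G by blast
qed

lemma orthonormal_representation:
  assumes "z \<in> span {t a b | a b. True}"
  shows "\<exists>F c. orthonormal F \<and> z = (\<Sum>e\<in>F. t e (c e))"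
proof -
  have "{t a b | a b. True} = fst ` {(t a b, t a (id_blinfun b)) | a b. True}" by force
  then have "z \<in> fst ` span {(t a b, t a (id_blinfun b)) | a b. True}"
    using assms by (simp add: linear_span_image[OF linear_fst])
  then obtain y where "(z, y) \<in> span {(t a b, t a (id_blinfun b)) | a b. True}" by force
  from orthonormal_representation_pair[OF BH_id this] show ?thesis by auto
qed

lemma cinner_orthonormal_sum:
  assumes "orthonormal F"
  shows "cinner (\<Sum>e\<in>F. t e (c e)) (\<Sum>e\<in>F. t e (d e)) = (\<Sum>e\<in>F. cinner (c e) (d e))"
proof -
  have "cinner (\<Sum>e\<in>F. t e (c e)) (\<Sum>e\<in>F. t e (d e)) =
    (\<Sum>e\<in>F. \<Sum>f\<in>F. if e = f then cinner (c e) (d f) else 0)"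
    unfolding cinner_sum_left cinner_sum_right using assms
    by (intro sum.cong refl) (simp add: cinner_t orthonormal_def)
  also have "\<dots> = (\<Sum>e\<in>F. cinner (c e) (d e))"
    using assms by (simp add: orthonormal_def)
  finally show ?thesis .
qed

lemma norm_orthonormal_sum:
  assumes "orthonormal F"
  shows "(norm (\<Sum>e\<in>F. t e (c e)))\<^sup>2 = (\<Sum>e\<in>F. (norm (c e))\<^sup>2)"
proof -
  have "complex_of_real ((norm (\<Sum>e\<in>F. t e (c e)))\<^sup>2) = of_real (\<Sum>e\<in>F. (norm (c e))\<^sup>2)"
    using cinner_orthonormal_sum[OF assms, of c c] by (simp add: cinner_self)
  then show ?thesis by (simp only: of_real_eq_iff)
qed

text \<open>The ampliation \<open>x \<mapsto> 1 \<otimes> x\<close>.\<close>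

abbreviation amp :: "('b \<Rightarrow>\<^sub>L 'b) \<Rightarrow> 'c \<Rightarrow>\<^sub>L 'c" where
  "amp \<equiv> op_tensor t id_blinfun"

lemma amp_exists:
  assumes x: "x \<in> BH"
  shows "\<exists>T. T \<in> BH \<and> (\<forall>a b. blinfun_apply T (t a b) = t a (blinfun_apply x b))"
proof -
  let ?S = "{(t a b, t a (blinfun_apply x b)) | a b. True}"
  have bound: "norm v \<le> norm u * norm x" if uv: "(u, v) \<in> span ?S" for u v
  proof -
    obtain F c where F: "orthonormal F" and u: "u = (\<Sum>e\<in>F. t e (c e))" and v: "v = (\<Sum>e\<in>F. t e (x (c e)))"
      using orthonormal_representation_pair[OF x uv] by auto
    have "(norm v)\<^sup>2 \<le> (\<Sum>e\<in>F. (norm x * norm (c e))\<^sup>2)"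
      unfolding v norm_orthonormal_sum[OF F] by (intro sum_mono power_mono norm_blinfun norm_ge_zero)
    also have "\<dots> = (norm u * norm x)\<^sup>2"
      by (simp add: u norm_orthonormal_sum[OF F] power_mult_distrib sum_distrib_left mult.commute)
    finally show ?thesis by (rule power2_le_imp_le) simp
  qed
  have dom: "closure (fst ` span ?S) = UNIV"
  proof -
    have "fst ` ?S = {t a b | a b. True}" by force
    then show ?thesis using dense by (simp add: linear_span_image[OF linear_fst, symmetric])
  qed
  obtain T where T: "\<And>u v. (u, v) \<in> span ?S \<Longrightarrow> blinfun_apply T u = v"
    using bounded_extension[OF subspace_span bound dom] by blast
  have t: "T (t a b) = t a (x b)" for a b
    by (intro T span_base) blast
  have "T \<odot> scale_op c id_blinfun = scale_op c T" for c
    by (rule tensor_eqI) (simp add: t x BH_scaleC t_scaleC_right[symmetric])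
  then have "T (c *\<^sub>C z) = c *\<^sub>C T z" for c z
    using arg_cong[of _ _ "\<lambda>S. blinfun_apply S z"] by fastforce
  then show ?thesis using t by (auto simp: BH_def)
qed

lemma amp_characterization:
  assumes "x \<in> BH"
  shows "amp x \<in> BH \<and> (\<forall>a b. amp x (t a b) = t a (x b))"
proof -
  have "\<exists>!T. T \<in> BH \<and> (\<forall>a b. blinfun_apply T (t a b) = t (blinfun_apply id_blinfun a) (blinfun_apply x b))"
    using amp_exists[OF assms] by (auto intro: tensor_eqI)
  from theI'[OF this] show ?thesis unfolding op_tensor_def by simp
qed

lemma amp_BH [simp]: "x \<in> BH \<Longrightarrow> amp x \<in> BH"
  and amp_t [simp]: "x \<in> BH \<Longrightarrow> amp x (t a b) = t a (x b)"
  using amp_characterization by blast+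

lemma amp_id: "amp id_blinfun = id_blinfun"
  by (rule tensor_eqI) simp

lemma amp_add: "x \<in> BH \<Longrightarrow> y \<in> BH \<Longrightarrow> amp (x + y) = amp x + amp y"
  by (rule tensor_eqI) (simp add: blinfun.add_left t_add_right)

lemma amp_scale: "x \<in> BH \<Longrightarrow> amp (scale_op c x) = scale_op c (amp x)"
  by (rule tensor_eqI) (simp add: t_scaleC_right)

lemma adj_leg_amp:
  assumes "x \<in> BH"
  shows "adj (leg t e) (amp x z) = x (adj (leg t e) z)"
proof -
  have "adj (leg t e) \<odot> amp x = x \<odot> adj (leg t e)"
    by (rule tensor_eqI) (simp add: assms adj_leg_t BH_scaleC)
  then show ?thesis by (metis blinfun_apply_blinfun_compose)
qed

lemma amp_positive:
  assumes "positive_op x"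
  shows "positive_op (amp x)"
proof -
  have x [simp]: "x \<in> BH" using assms by (simp add: positive_op_def)
  let ?P = "{z. Im (cinner z (amp x z)) = 0 \<and> 0 \<le> Re (cinner z (amp x z))}"
  have "span {t a b | a b. True} \<subseteq> ?P"
  proof
    fix z assume "z \<in> span {t a b | a b. True}"
    then obtain F c where F: "orthonormal F" and z: "z = (\<Sum>e\<in>F. t e (c e))"
      using orthonormal_representation by blast
    have "cinner z (amp x z) = (\<Sum>e\<in>F. cinner (c e) (x (c e)))"
      unfolding z by (simp add: blinfun.sum_right cinner_orthonormal_sum[OF F])
    then show "z \<in> ?P"
      using assms by (auto simp: positive_op_def intro: sum_nonneg)
  qed
  moreover have "closed ?P"
    by (intro closed_Collect_conj closed_Collect_eq closed_Collect_le continuous_intros)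
  ultimately have "closure (span {t a b | a b. True}) \<subseteq> ?P"
    by (rule closure_minimal)
  then show ?thesis using dense by (auto simp: positive_op_def)
qed

text \<open>This is \<open>(P \<otimes> 1) z\<close> for the orthogonal projection \<open>P\<close> onto the span of the orthonormal
  set \<open>F\<close>.\<close>

definition compress :: "'a set \<Rightarrow> 'c \<Rightarrow> 'c" where
  "compress F z = (\<Sum>e\<in>F. t e (adj (leg t e) z))"

lemma adj_leg_compress_remainder:
  assumes "orthonormal F" "e \<in> F"
  shows "adj (leg t e) (z - compress F z) = 0"
proof -
  have "adj (leg t e) (compress F z) = (\<Sum>f\<in>F. if e = f then adj (leg t f) z else 0)"
    unfolding compress_def blinfun.sum_right adj_leg_t using assms
    by (intro sum.cong refl) (auto simp: orthonormal_def)
  also have "\<dots> = adj (leg t e) z" using assms by (simp add: orthonormal_def)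
  finally show ?thesis by (simp add: blinfun.diff_right)
qed

text \<open>The operator \<open>1 \<otimes> y\<close> commutes with \<open>P \<otimes> 1\<close>, so the form is the sum of its restrictions to
  the range and the kernel of \<open>P \<otimes> 1\<close>. For positive \<open>y\<close> the remainder is nonnegative.\<close>

lemma quadratic_form_split:
  assumes F: "orthonormal F" and y: "y \<in> BH"
  shows "cinner z (amp y z) = (\<Sum>e\<in>F. cinner (adj (leg t e) z) (y (adj (leg t e) z))) +
    cinner (z - compress F z) (amp y (z - compress F z))"
proof -
  define p where "p = compress F z"
  define r where "r = z - p"
  have r: "adj (leg t e) r = 0" if "e \<in> F" for e
    unfolding r_def p_def by (rule adj_leg_compress_remainder[OF F that])
  have amp_p: "amp y p = (\<Sum>e\<in>F. t e (y (adj (leg t e) z)))"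
    unfolding p_def compress_def using y by (simp add: blinfun.sum_right)
  have t_r: "cinner (t e b) w = cinner b (adj (leg t e) w)" "cinner w (t e b) = cinner (adj (leg t e) w) b" for e b w
    using cinner_adj_right[OF leg_BH, of b e w] cinner_adj_left[OF leg_BH, of e w b] by simp_all
  have "cinner r (amp y p) = 0"
    unfolding amp_p cinner_sum_right using r by (simp add: t_r)
  moreover have "cinner p (amp y r) = 0"
    unfolding p_def compress_def cinner_sum_left
    using r y by (simp add: t_r adj_leg_amp blinfun.zero_right)
  moreover have "cinner p (amp y p) = (\<Sum>e\<in>F. cinner (adj (leg t e) z) (y (adj (leg t e) z)))"
    unfolding amp_p unfolding p_def compress_def by (rule cinner_orthonormal_sum[OF F])
  moreover have "z = p + r" by (simp add: r_def)
  then have "cinner z (amp y z) = cinner p (amp y p) + cinner p (amp y r) + cinner r (amp y p) + cinner r (amp y r)"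
    by (simp add: blinfun.add_right cinner_simps)
  ultimately show ?thesis by (simp add: r_def p_def)
qed

text \<open>If \<open>z\<close> is close to a finite sum with left factors in \<open>F\<close>, the remainder in
  \<open>quadratic_form_split\<close> is small: the projection along \<open>F\<close> is at least as close to \<open>z\<close> as that
  sum.\<close>

lemma quadratic_form_approx:
  assumes y: "y \<in> BH" and eps: "\<epsilon> > 0"
  shows "\<exists>F. orthonormal F \<and>
    Re (cinner z (amp y z)) \<le> (\<Sum>e\<in>F. Re (cinner (adj (leg t e) z) (y (adj (leg t e) z)))) + \<epsilon>"
proof -
  define K where "K = norm (amp y) + 1"
  define \<delta> where "\<delta> = min 1 (\<epsilon> / K)"
  have K: "K > 0" "norm (amp y) \<le> K" unfolding K_def by (auto intro: add_nonneg_pos)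
  have d: "\<delta> > 0" "\<delta> \<le> 1" "\<delta> \<le> \<epsilon> / K" using K eps by (auto simp: \<delta>_def)
  have "z \<in> closure (span {t a b | a b. True})" using dense by simp
  then obtain z0 where z0: "z0 \<in> span {t a b | a b. True}" "dist z0 z < \<delta>"
    using d(1) closure_approachable by blast
  obtain F c where F: "orthonormal F" and c: "z0 = (\<Sum>e\<in>F. t e (c e))"
    using orthonormal_representation[OF z0(1)] by blast
  define r where "r = z - compress F z"
  have "cinner r (t e b) = 0" if "e \<in> F" for e b
    using adj_leg_compress_remainder[OF F that, of z] cinner_adj_left[OF leg_BH, of e r b]
    by (simp add: r_def)
  then have "cinner r (compress F z) = 0" "cinner r z0 = 0"
    by (simp_all add: compress_def c cinner_sum_right)
  then have "cinner r r = cinner r (z - z0)"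
    by (subst (2) r_def) (simp add: cinner_diff_right)
  then have "(norm r)\<^sup>2 \<le> norm r * norm (z - z0)"
    using norm_cinner_le[of r "z - z0"] by (metis cinner_self norm_of_real abs_power2 power2_abs)
  then have "norm r \<le> norm (z - z0)"
    by (cases "norm r = 0") (auto simp: power2_eq_square)
  then have r: "norm r \<le> \<delta>" using z0(2) by (simp add: dist_norm norm_minus_commute)
  have "Re (cinner r (amp y r)) \<le> norm r * norm (amp y r)"
    using complex_Re_le_cmod norm_cinner_le order_trans by blast
  also have "\<dots> \<le> norm r * (norm (amp y) * norm r)"
    by (intro mult_left_mono norm_blinfun) simp
  also have "\<dots> \<le> 1 * (K * \<delta>)"
    using r d K by (intro mult_mono) auto
  also have "\<dots> \<le> \<epsilon>" using d(3) K by (simp add: field_simps)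
  finally have "Re (cinner z (amp y z)) \<le> (\<Sum>e\<in>F. Re (cinner (adj (leg t e) z) (y (adj (leg t e) z)))) + \<epsilon>"
    using quadratic_form_split[OF F y, of z] by (simp add: r_def)
  then show ?thesis using F by blast
qed

section \<open>Slice maps\<close>

text \<open>Lets slices over the right factor reuse the creation operators for the left one.\<close>

lemma flipped_tensor: "hilbert_tensor_product (\<lambda>b a. t a b)"
proof
  have "{t a b | b a. True} = {t a b | a b. True}" by blast
  then show "hilbert_tensor (\<lambda>b a. t a b)"
    using tensor unfolding hilbert_tensor_def by (simp add: mult.commute)
qed

lemma vector_slice_characterization:
  assumes X: "X \<in> BH"
  shows "vector_slice t \<xi> \<eta> X \<in> BH \<and>
    (\<forall>a b. cinner b (vector_slice t \<xi> \<eta> X a) = cinner (t b \<eta>) (X (t a \<xi>)))"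
proof -
  interpret fl: hilbert_tensor_product "\<lambda>b a. t a b" by (rule flipped_tensor)
  let ?R = "adj (leg (\<lambda>b a. t a b) \<eta>) \<odot> X \<odot> leg (\<lambda>b a. t a b) \<xi>"
  have "\<exists>!R. R \<in> BH \<and> (\<forall>a b. cinner b (blinfun_apply R a) = cinner (t b \<eta>) (blinfun_apply X (t a \<xi>)))"
  proof (rule ex1I[of _ ?R])
    show "?R \<in> BH \<and> (\<forall>a b. cinner b (blinfun_apply ?R a) = cinner (t b \<eta>) (blinfun_apply X (t a \<xi>)))"
      using X by (simp add: cinner_adj_right)
    fix R
    assume "R \<in> BH \<and> (\<forall>a b. cinner b (blinfun_apply R a) = cinner (t b \<eta>) (blinfun_apply X (t a \<xi>)))"
    then show "R = ?R"
      by (intro blinfun_eqI cinner_eqI) (simp add: cinner_adj_right)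
  qed
  from theI'[OF this] show ?thesis unfolding vector_slice_def .
qed

lemma slice_left_eqI:
  assumes "S \<in> BH" "\<And>\<xi> \<eta>. cinner \<eta> (blinfun_apply S \<xi>) = \<omega> (vector_slice t \<xi> \<eta> X)"
  shows "slice_left t \<omega> X = S"
  unfolding slice_left_def
proof (rule the_equality)
  fix S'
  assume "S' \<in> BH \<and> (\<forall>\<xi> \<eta>. cinner \<eta> (blinfun_apply S' \<xi>) = \<omega> (vector_slice t \<xi> \<eta> X))"
  then show "S' = S"
    by (intro blinfun_eqI cinner_eqI) (simp add: assms(2))
qed (use assms in blast)

lemma slice_left_vector_functional:
  assumes X: "X \<in> BH"
  shows "slice_left t (\<lambda>y. cinner \<eta> (blinfun_apply y \<xi>)) X = adj (leg t \<eta>) \<odot> X \<odot> leg t \<xi>"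
  using X vector_slice_characterization[OF X] by (intro slice_left_eqI) (simp_all add: cinner_adj_right)

lemma norm_vector_functional_slice_le:
  assumes X: "X \<in> BH"
  shows "norm (adj (leg t \<eta>) \<odot> X \<odot> leg t \<xi>) \<le> norm X * ((norm \<xi>)\<^sup>2 + (norm \<eta>)\<^sup>2)"
proof -
  have "norm (adj (leg t \<eta>) \<odot> X \<odot> leg t \<xi>) \<le> norm (adj (leg t \<eta>) \<odot> X) * norm (leg t \<xi>)"
    by (rule norm_blinfun_compose)
  also have "\<dots> \<le> (norm \<eta> * norm X) * norm \<xi>"
    by (intro mult_mono norm_leg_le order_trans[OF norm_blinfun_compose] mult_right_mono
        order_trans[OF norm_adj_le[OF leg_BH]]) auto
  also have "\<dots> = norm X * (norm \<xi> * norm \<eta>)" by simp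
  also have "\<dots> \<le> norm X * ((norm \<xi>)\<^sup>2 + (norm \<eta>)\<^sup>2)"
  proof (rule mult_left_mono)
    have "2 * (norm \<xi> * norm \<eta>) \<le> (norm \<xi>)\<^sup>2 + (norm \<eta>)\<^sup>2"
      using sum_squares_bound[of "norm \<xi>" "norm \<eta>"] by simp
    moreover have "0 \<le> norm \<xi> * norm \<eta>" by simp
    ultimately show "norm \<xi> * norm \<eta> \<le> (norm \<xi>)\<^sup>2 + (norm \<eta>)\<^sup>2" by linarith
  qed simp
  finally show ?thesis .
qed

text \<open>A normal functional is a series of vector functionals. The slices by the latter are bounded
  by a summable sequence, so the slice is a norm convergent series. Norm convergence is what a
  non-normal \<open>E\<close> respects.\<close>

lemma slice_left_sums:
  assumes X: "X \<in> BH"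
    and \<xi>: "summable (\<lambda>n. (norm (\<xi> n))\<^sup>2)" and \<eta>: "summable (\<lambda>n. (norm (\<eta> n))\<^sup>2)"
    and \<omega>: "\<And>x. x \<in> BH \<Longrightarrow> \<omega> x = (\<Sum>n. cinner (\<eta> n) (blinfun_apply x (\<xi> n)))"
  shows "(\<lambda>n. adj (leg t (\<eta> n)) \<odot> X \<odot> leg t (\<xi> n)) sums slice_left t \<omega> X"
proof -
  define f where "f n = adj (leg t (\<eta> n)) \<odot> X \<odot> leg t (\<xi> n)" for n
  have f_BH: "f n \<in> BH" for n using X by (simp add: f_def)
  have "summable f"
  proof (rule summable_comparison_test')
    show "summable (\<lambda>n. norm X * ((norm (\<xi> n))\<^sup>2 + (norm (\<eta> n))\<^sup>2))"
      by (intro summable_mult summable_add \<xi> \<eta>)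
    show "norm (f n) \<le> norm X * ((norm (\<xi> n))\<^sup>2 + (norm (\<eta> n))\<^sup>2)" for n
      unfolding f_def by (rule norm_vector_functional_slice_le[OF X])
  qed
  then have f: "f sums suminf f" by (rule summable_sums)
  have "slice_left t \<omega> X = suminf f"
  proof (rule slice_left_eqI)
    show "suminf f \<in> BH" by (rule BH_suminf[OF \<open>summable f\<close> f_BH])
    fix \<xi>' \<eta>'
    have "(\<lambda>n. cinner \<eta>' (f n \<xi>')) sums cinner \<eta>' (suminf f \<xi>')"
      by (rule bounded_linear.sums[OF bounded_bilinear.bounded_linear_right[OF bounded_bilinear_cinner]
            bounded_linear.sums[OF blinfun.bounded_linear_left f]])
    moreover have "cinner \<eta>' (f n \<xi>') = cinner (\<eta> n) (vector_slice t \<xi>' \<eta>' X (\<xi> n))" for n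
      using vector_slice_characterization[OF X] by (simp add: f_def cinner_adj_right)
    ultimately show "cinner \<eta>' (suminf f \<xi>') = \<omega> (vector_slice t \<xi>' \<eta>' X)"
      using vector_slice_characterization[OF X] by (simp add: \<omega> sums_iff)
  qed
  then show ?thesis using f by (simp add: f_def[abs_def])
qed

end

lemma vector_functional_trace_class:
  "(\<lambda>y. cinner \<eta> (blinfun_apply y \<xi>)) \<in> trace_class_functionals"
proof -
  \<comment> \<open>the functional as a series with a single nonzero term\<close>
  let ?s = "\<lambda>v n. if n = (0::nat) then v else 0"
  have sq: "summable (\<lambda>n. (norm (?s v n))\<^sup>2)" for v :: 'a
    by (rule summable_finite[of "{0}"]) auto
  have "(\<Sum>n. cinner (?s \<eta> n) (blinfun_apply x (?s \<xi> n))) = cinner \<eta> (blinfun_apply x \<xi>)" for x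
    by (subst suminf_finite[of "{0}"]) auto
  then show ?thesis
    unfolding trace_class_functionals_def using sq[of \<xi>] sq[of \<eta>]
    by (intro CollectI exI[of _ "?s \<xi>"] exI[of _ "?s \<eta>"]) simp
qed

section \<open>Automatic covariance\<close>

lemma commutant_BH: "commutant A \<subseteq> BH"
  by (auto simp: commutant_def)

lemma id_commutant: "id_blinfun \<in> commutant A"
  by (simp add: commutant_def)

lemma compose_commutant: "S \<in> commutant A \<Longrightarrow> T \<in> commutant A \<Longrightarrow> S \<odot> T \<in> commutant A"
  unfolding commutant_def by (auto simp: compose_assoc) (metis compose_assoc)

text \<open>Every self-adjoint operator is a difference of a positive one and a scalar.\<close>

lemma norm_shift_positive:
  assumes x: "selfadjoint x" and c: "norm x \<le> c"
  shows "positive_op (c *\<^sub>R id_blinfun - x)" "positive_op (c *\<^sub>R id_blinfun + x)"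
proof -
  note [simp] = selfadjoint_BH[OF x]
  have "\<bar>Re (cinner h (x h))\<bar> \<le> c * (norm h)\<^sup>2" for h
  proof -
    have "\<bar>Re (cinner h (x h))\<bar> \<le> norm h * norm (x h)"
      using abs_Re_le_cmod norm_cinner_le order_trans by blast
    also have "\<dots> \<le> norm h * (norm x * norm h)" by (intro mult_left_mono norm_blinfun) simp
    also have "\<dots> = norm x * (norm h)\<^sup>2" by (simp add: power2_eq_square)
    also have "\<dots> \<le> c * (norm h)\<^sup>2" using c by (rule mult_right_mono) simp
    finally show ?thesis .
  qed
  then have b: "Re (cinner h (x h)) \<le> c * (norm h)\<^sup>2" "0 \<le> c * (norm h)\<^sup>2 + Re (cinner h (x h))" for h
    by (smt (verit))+
  show "positive_op (c *\<^sub>R id_blinfun - x)" "positive_op (c *\<^sub>R id_blinfun + x)"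
    using b selfadjoint_Im[OF x]
    by (auto simp: positive_op_def blinfun.diff_left blinfun.add_left blinfun.scaleR_left
        cinner_simps cinner_self)
qed

text \<open>The abstract situation of the theorem: \<open>W\<close> is a unitary all of whose vector slices lie in the
  range of \<open>E\<close>.\<close>

locale implemented_projection = norm_one_projection N E + hilbert_tensor_product t
  for t :: "'h::complex_hilbert \<Rightarrow> 'h \<Rightarrow> 'h2::complex_hilbert" and N :: "('h \<Rightarrow>\<^sub>L 'h) set" and E +
  fixes W :: "'h2 \<Rightarrow>\<^sub>L 'h2"
  assumes unitary: "unitary_op W"
    and W_slices: "\<And>\<xi> \<eta>. adj (leg t \<eta>) \<odot> W \<odot> leg t \<xi> \<in> N"
begin

lemma W_BH [simp]: "W \<in> BH"
  using unitary by (simp add: unitary_op_def)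

text \<open>The slice of \<open>W\<^sup>*(1 \<otimes> x)W\<close> by the vector functional of \<open>\<xi>\<close> and \<open>\<eta>\<close>.\<close>

definition conj_slice :: "'h \<Rightarrow> 'h \<Rightarrow> ('h \<Rightarrow>\<^sub>L 'h) \<Rightarrow> 'h \<Rightarrow>\<^sub>L 'h" where
  "conj_slice \<eta> \<xi> x = adj (leg t \<eta>) \<odot> (adj W \<odot> amp x \<odot> W) \<odot> leg t \<xi>"

lemma conj_slice_BH [simp]: "x \<in> BH \<Longrightarrow> conj_slice \<eta> \<xi> x \<in> BH"
  by (simp add: conj_slice_def)

lemma conj_slice_add: "x \<in> BH \<Longrightarrow> y \<in> BH \<Longrightarrow> conj_slice \<eta> \<xi> (x + y) = conj_slice \<eta> \<xi> x + conj_slice \<eta> \<xi> y"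
  by (simp add: conj_slice_def amp_add compose_distribs)

lemma conj_slice_scale: "x \<in> BH \<Longrightarrow> conj_slice \<eta> \<xi> (scale_op c x) = scale_op c (conj_slice \<eta> \<xi> x)"
  by (simp add: conj_slice_def amp_scale compose_scale_op)

lemma conj_slice_scaleR: "x \<in> BH \<Longrightarrow> conj_slice \<eta> \<xi> (r *\<^sub>R x) = r *\<^sub>R conj_slice \<eta> \<xi> x"
  by (simp add: scaleR_eq_scale_op conj_slice_scale)

lemma conj_slice_diff: "x \<in> BH \<Longrightarrow> y \<in> BH \<Longrightarrow> conj_slice \<eta> \<xi> (x - y) = conj_slice \<eta> \<xi> x - conj_slice \<eta> \<xi> y"
  using conj_slice_add[of x "-1 *\<^sub>R y"] conj_slice_scaleR[of y _ _ "-1"] by simp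

text \<open>Here unitarity of \<open>W\<close> enters; this is what turns the inequality below into an equality.\<close>

lemma conj_slice_id: "conj_slice \<xi> \<xi> id_blinfun = (norm \<xi>)\<^sup>2 *\<^sub>R id_blinfun"
proof -
  have "adj W \<odot> W = id_blinfun" using unitary by (simp add: unitary_op_def)
  then show ?thesis
    by (intro blinfun_eqI)
       (simp add: conj_slice_def amp_id adj_leg_t cinner_self blinfun.scaleR_left scaleR_eq_scaleC)
qed

lemma cinner_conj_slice:
  "x \<in> BH \<Longrightarrow> cinner h (conj_slice \<xi> \<xi> x h) = cinner (W (t \<xi> h)) (amp x (W (t \<xi> h)))"
  by (simp add: conj_slice_def cinner_adj_right)

lemma conj_slice_positive: "positive_op x \<Longrightarrow> positive_op (conj_slice \<xi> \<xi> x)"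
  using amp_positive[of x] by (auto simp: positive_op_def cinner_conj_slice)

text \<open>The finite sums \<open>B\<close> of \<open>(a e)\<^sup>*x(a e)\<close> lie below the slice for \<open>x\<close>. Positivity and the bimodule
  property of \<open>E\<close> turn this into a bound on \<open>E\<close> of that slice from below by the finite sums
  for \<open>E x\<close>, and these approximate the slice for \<open>E x\<close>.\<close>

lemma conj_slice_E_le:
  assumes x: "positive_op x"
  shows "Re (cinner h (conj_slice \<xi> \<xi> (E x) h)) \<le> Re (cinner h (E (conj_slice \<xi> \<xi> x) h))"
proof (rule field_le_epsilon)
  fix \<epsilon> :: real assume eps: "0 < \<epsilon>"
  have xBH [simp]: "x \<in> BH" using x by (simp add: positive_op_def)
  define z where "z = W (t \<xi> h)"
  obtain F where F: "orthonormal F" and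
    approx: "Re (cinner z (amp (E x) z)) \<le>
      (\<Sum>e\<in>F. Re (cinner (adj (leg t e) z) (E x (adj (leg t e) z)))) + \<epsilon>"
    using quadratic_form_approx[OF N_BH[OF E_in_N[OF xBH]] eps, of z] by blast
  define a where "a e = adj (leg t e) \<odot> W \<odot> leg t \<xi>" for e
  have a [simp]: "a e \<in> N" for e unfolding a_def by (rule W_slices)
  \<comment> \<open>the truncation of the slice to the left factors in \<open>F\<close>\<close>
  define B where "B = (\<Sum>e\<in>F. adj (a e) \<odot> x \<odot> a e)"
  have B_BH [simp]: "B \<in> BH" by (simp add: B_def)
  have "positive_op (conj_slice \<xi> \<xi> x - B)"
    unfolding positive_op_def
  proof (intro conjI allI)
    fix k
    define y where "y = W (t \<xi> k)"
    have "cinner k ((conj_slice \<xi> \<xi> x - B) k) = cinner (y - compress F y) (amp x (y - compress F y))"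
      using quadratic_form_split[OF F, of x y]
      by (simp add: blinfun.diff_left cinner_diff_right cinner_conj_slice B_def blinfun.sum_left
        cinner_sum_right cinner_adj_right a_def y_def)
    then show "Im (cinner k ((conj_slice \<xi> \<xi> x - B) k)) = 0" "0 \<le> Re (cinner k ((conj_slice \<xi> \<xi> x - B) k))"
      using amp_positive[OF x] by (auto simp: positive_op_def)
  qed simp
  then have "0 \<le> Re (cinner h (E (conj_slice \<xi> \<xi> x - B) h))"
    using E_positive by (simp add: positive_op_def)
  also have "E (conj_slice \<xi> \<xi> x - B) = E (conj_slice \<xi> \<xi> x) - (\<Sum>e\<in>F. adj (a e) \<odot> E x \<odot> a e)"
    by (simp add: E_diff B_def E_sum tomiyama_left tomiyama_right)
  finally have "Re (cinner h ((\<Sum>e\<in>F. adj (a e) \<odot> E x \<odot> a e) h)) \<le> Re (cinner h (E (conj_slice \<xi> \<xi> x) h))"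
    by (simp add: blinfun.diff_left cinner_diff_right)
  also have "Re (cinner h ((\<Sum>e\<in>F. adj (a e) \<odot> E x \<odot> a e) h)) =
      (\<Sum>e\<in>F. Re (cinner (adj (leg t e) z) (E x (adj (leg t e) z))))"
    by (simp add: blinfun.sum_left cinner_sum_right cinner_adj_right a_def z_def)
  finally show "Re (cinner h (conj_slice \<xi> \<xi> (E x) h)) \<le> Re (cinner h (E (conj_slice \<xi> \<xi> x) h)) + \<epsilon>"
    using approx by (simp add: cinner_conj_slice z_def)
qed

text \<open>The inequality for \<open>\<parallel>x\<parallel> - x\<close> is the reverse of the inequality for \<open>x\<close>, since the slice of
  the identity is a scalar.\<close>

lemma E_conj_slice_positive:
  assumes x: "positive_op x"
  shows "E (conj_slice \<xi> \<xi> x) = conj_slice \<xi> \<xi> (E x)"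
proof (rule op_eqI_quadratic)
  have [simp]: "x \<in> BH" using x by (simp add: positive_op_def)
  show "E (conj_slice \<xi> \<xi> x) \<in> BH" "conj_slice \<xi> \<xi> (E x) \<in> BH" by simp_all
  fix h
  let ?c = "norm x"
  have "positive_op (?c *\<^sub>R id_blinfun - x)"
    by (rule norm_shift_positive[OF positive_op_selfadjoint[OF x]]) simp
  from conj_slice_E_le[OF this, of h \<xi>]
  have "Re (cinner h (E (conj_slice \<xi> \<xi> x) h)) \<le> Re (cinner h (conj_slice \<xi> \<xi> (E x) h))"
    by (simp add: E_diff E_scaleR conj_slice_diff conj_slice_scaleR conj_slice_id
        blinfun.diff_left cinner_diff_right)
  moreover note conj_slice_E_le[OF x, of h \<xi>]
  moreover have "Im (cinner h (E (conj_slice \<xi> \<xi> x) h)) = 0" "Im (cinner h (conj_slice \<xi> \<xi> (E x) h)) = 0"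
    using E_positive[OF conj_slice_positive[OF x]] conj_slice_positive[OF E_positive[OF x]]
    by (auto simp: positive_op_def)
  ultimately show "cinner h (E (conj_slice \<xi> \<xi> x) h) = cinner h (conj_slice \<xi> \<xi> (E x) h)"
    by (simp add: complex_eq_iff)
qed

lemma E_conj_slice_diagonal:
  assumes x: "x \<in> BH"
  shows "E (conj_slice \<xi> \<xi> x) = conj_slice \<xi> \<xi> (E x)"
proof -
  have sa: "E (conj_slice \<xi> \<xi> y) = conj_slice \<xi> \<xi> (E y)" if y: "selfadjoint y" for y
  proof -
    note [simp] = selfadjoint_BH[OF y]
    have "positive_op (norm y *\<^sub>R id_blinfun + y)"
      by (rule norm_shift_positive[OF y]) simp
    from E_conj_slice_positive[OF this, of \<xi>] show ?thesis
      by (simp add: E_add E_scaleR conj_slice_add conj_slice_scaleR conj_slice_id)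
  qed
  obtain a b where ab: "selfadjoint a" "selfadjoint b" "x = a + scale_op \<i> b"
    using cartesian_decomposition[OF x] by metis
  note [simp] = selfadjoint_BH[OF ab(1)] selfadjoint_BH[OF ab(2)]
  show ?thesis
    by (simp add: ab(3) E_add E_scale conj_slice_add conj_slice_scale sa ab(1,2))
qed

text \<open>Polarization: the difference of the two sides is conjugate-linear in \<open>\<eta>\<close>, linear in \<open>\<xi>\<close>, and zero on
  the diagonal.\<close>

lemma E_conj_slice:
  assumes x [simp]: "x \<in> BH"
  shows "E (conj_slice \<eta> \<xi> x) = conj_slice \<eta> \<xi> (E x)"
proof -
  define D where "D \<eta> \<xi> = E (conj_slice \<eta> \<xi> x) - conj_slice \<eta> \<xi> (E x)" for \<eta> \<xi>
  have diag: "D \<xi> \<xi> = 0" for \<xi> by (simp add: D_def E_conj_slice_diagonal)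
  have add: "D (\<eta> + \<eta>') \<xi> = D \<eta> \<xi> + D \<eta>' \<xi>" "D \<eta> (\<xi> + \<xi>') = D \<eta> \<xi> + D \<eta> \<xi>'" for \<eta> \<eta>' \<xi> \<xi>'
    by (simp_all add: D_def conj_slice_def leg_add adj_add compose_distribs E_add algebra_simps)
  have scl: "D (\<i> *\<^sub>C \<eta>) \<xi> = scale_op (- \<i>) (D \<eta> \<xi>)" "D \<eta> (\<i> *\<^sub>C \<xi>) = scale_op \<i> (D \<eta> \<xi>)" for \<eta> \<xi>
    by (simp_all add: D_def conj_slice_def leg_scaleC adj_scale_op compose_scale_op E_scale scale_op_diff)
  have 1: "D \<eta> \<xi> + D \<xi> \<eta> = 0"
    using diag[of "\<eta> + \<xi>"] unfolding add unfolding diag by (simp add: add.commute)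
  have "scale_op \<i> (D \<eta> \<xi>) + scale_op (- \<i>) (D \<xi> \<eta>) = 0"
    using diag[of "\<eta> + \<i> *\<^sub>C \<xi>"] unfolding add unfolding diag by (simp add: scl add.commute)
  then have "scale_op \<i> (D \<eta> \<xi> - D \<xi> \<eta>) = 0"
    by (simp add: scale_op_minus scale_op_diff)
  then have "scale_op (- \<i>) (scale_op \<i> (D \<eta> \<xi> - D \<xi> \<eta>)) = 0" by simp
  moreover have "scale_op (- \<i>) (scale_op \<i> T) = T" for T :: "'h \<Rightarrow>\<^sub>L 'h"
    by (rule blinfun_eqI) (simp add: scaleC_scaleC)
  ultimately have "D \<eta> \<xi> = D \<xi> \<eta>" by simp
  with 1 have "D \<eta> \<xi> = 0" using double_cancel[of "D \<eta> \<xi>" 0] by simp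
  then show ?thesis by (simp add: D_def)
qed

lemma E_sums:
  assumes T: "\<And>n. T n \<in> BH" and s: "T sums s"
  shows "(\<lambda>n. E (T n)) sums E s"
proof -
  have s_BH: "s \<in> BH" using BH_suminf[of T] T s by (simp add: sums_iff)
  have bound: "norm ((\<Sum>i<n. E (T i)) - E s) \<le> norm ((\<Sum>i<n. T i) - s)" for n
    using norm_E_le[of "(\<Sum>i<n. T i) - s"] T s_BH by (simp add: E_diff E_sum)
  have lim: "(\<lambda>n. norm ((\<Sum>i<n. T i) - s)) \<longlonglongrightarrow> 0"
    using s unfolding sums_def by (simp add: LIM_zero tendsto_norm_zero)
  have "(\<lambda>n. (\<Sum>i<n. E (T i)) - E s) \<longlonglongrightarrow> 0"
    by (rule Lim_null_comparison[OF always_eventually[OF allI[OF bound]] lim])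
  then show ?thesis unfolding sums_def by (rule LIM_zero_cancel)
qed

theorem E_module_action:
  assumes x [simp]: "x \<in> BH" and \<omega>: "\<omega> \<in> trace_class_functionals"
  shows "E (module_action t W x \<omega>) = module_action t W (E x) \<omega>"
proof -
  obtain \<xi> \<eta> where "summable (\<lambda>n. (norm (\<xi> n))\<^sup>2)" "summable (\<lambda>n. (norm (\<eta> n))\<^sup>2)"
    "\<And>y. y \<in> BH \<Longrightarrow> \<omega> y = (\<Sum>n. cinner (\<eta> n) (blinfun_apply y (\<xi> n)))"
    using \<omega> unfolding trace_class_functionals_def by blast
  note sums = slice_left_sums[OF _ this]
  have action: "(\<lambda>n. conj_slice (\<eta> n) (\<xi> n) y) sums module_action t W y \<omega>" if "y \<in> BH" for y
    unfolding module_action_def conj_slice_def by (rule sums) (simp add: that)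
  have "(\<lambda>n. conj_slice (\<eta> n) (\<xi> n) (E x)) sums E (module_action t W x \<omega>)"
    using E_sums[OF _ action[OF x]] by (simp add: E_conj_slice)
  then show ?thesis using action[of "E x"] by (simp add: sums_unique2)
qed

end

text \<open>The generators of the dual algebra are given by functionals on \<open>M\<close>; a vector functional on
  \<open>\<B>(H)\<close> is an extension of its own restriction to \<open>M\<close>.\<close>

lemma slice_in_dual_algebra:
  assumes "hilbert_tensor t" "W \<in> BH"
  shows "adj (leg t \<eta>) \<odot> W \<odot> leg t \<xi> \<in> dual_algebra t M W"
proof -
  interpret hilbert_tensor_product t by standard fact
  let ?S = "{slice_left t \<omega> W | f \<omega>. f \<in> predual M \<and> \<omega> \<in> trace_class_functionals \<and> (\<forall>x\<in>M. \<omega> x = f x)}"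
  let ?\<omega> = "\<lambda>y. cinner \<eta> (blinfun_apply y \<xi>)"
  have "slice_left t ?\<omega> W \<in> ?S"
    using vector_functional_trace_class[of \<eta> \<xi>]
    by (intro CollectI exI[of _ "restrict ?\<omega> M"] exI[of _ ?\<omega>]) (auto simp: predual_def)
  then have "adj (leg t \<eta>) \<odot> W \<odot> leg t \<xi> \<in> ?S"
    by (simp only: slice_left_vector_functional[OF assms(2)])
  moreover have "adj (leg t \<eta>) \<odot> W \<odot> leg t \<xi> \<in> BH" using assms(2) by simp
  ultimately show ?thesis
    unfolding dual_algebra_def by (subst commutant_def) (auto simp: commutant_def)
qed

theorem theorem4p9:
  fixes t :: "'h::complex_hilbert \<Rightarrow> 'h \<Rightarrow> 'h2::complex_hilbert"
    and tL :: "'h2 \<Rightarrow> 'h \<Rightarrow> 'h3::complex_hilbert"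
    and tR :: "'h \<Rightarrow> 'h2 \<Rightarrow> 'h3"
    and M :: "('h \<Rightarrow>\<^sub>L 'h) set"
    and \<Gamma> :: "('h \<Rightarrow>\<^sub>L 'h) \<Rightarrow> ('h2 \<Rightarrow>\<^sub>L 'h2)"
    and \<phi> \<psi> :: "('h \<Rightarrow>\<^sub>L 'h) \<Rightarrow> ennreal"
    and \<Lambda> :: "('h \<Rightarrow>\<^sub>L 'h) \<Rightarrow> 'h"
    and W :: "'h2 \<Rightarrow>\<^sub>L 'h2"
  assumes "locally_compact_quantum_group t tL tR M \<Gamma> \<phi> \<psi> \<Lambda>"
    and "left_fundamental_unitary t M \<Gamma> \<phi> \<Lambda> W"
  shows "(\<exists>E. conditional_expectation (dual_algebra t M W) E \<and>
            (\<forall>x\<in>BH. \<forall>\<omega>\<in>trace_class_functionals.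
               E (module_action t W x \<omega>) = module_action t W (E x) \<omega>))
         \<longleftrightarrow> injective_vN (dual_algebra t M W)"
proof -
  have t: "hilbert_tensor t"
    using assms(1) by (simp add: locally_compact_quantum_group_def)
  have W: "unitary_op W" "W \<in> BH"
    using assms(2) by (simp_all add: left_fundamental_unitary_def unitary_op_def)
  have "E (module_action t W x \<omega>) = module_action t W (E x) \<omega>"
    if E: "conditional_expectation (dual_algebra t M W) E"
      and x: "x \<in> BH" and \<omega>: "\<omega> \<in> trace_class_functionals" for E x \<omega>
  proof -
    interpret implemented_projection t "dual_algebra t M W" E W
    proof
      show "dual_algebra t M W \<subseteq> BH" "id_blinfun \<in> dual_algebra t M W"
        unfolding dual_algebra_def by (rule commutant_BH id_commutant)+
      show "a \<odot> b \<in> dual_algebra t M W" if "a \<in> dual_algebra t M W" "b \<in> dual_algebra t M W" for a b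
        using that unfolding dual_algebra_def by (rule compose_commutant)
      show "adj (leg t \<eta>) \<odot> W \<odot> leg t \<xi> \<in> dual_algebra t M W" for \<xi> \<eta>
        by (rule slice_in_dual_algebra[OF t W(2)])
    qed (fact E t W(1))+
    show ?thesis by (rule E_module_action[OF x \<omega>])
  qed
  then show ?thesis
    unfolding injective_vN_def by blast
qed

end
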